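(* Let $n\ge1$, $\alpha_1,\dots,\alpha_n\in(0,1]$, and let $p_1,\dots,p_n$ be positive integers. For $i=1,\dots,n$ let $\boldsymbol{C}_i$ be a $p_i\times p_i$ sub-intensity matrix and $\boldsymbol{D}_i$ a matrix with nonnegative entries and $p_i$ rows, such that $\boldsymbol{D}_i$ has $p_{i+1}$ columns for $i<n$ and $-\boldsymbol{C}_i\boldsymbol{e}=\boldsymbol{D}_i\boldsymbol{e}$ for all $i$. Let $\boldsymbol{\pi}$ be a probability row vector of dimension $p_1$ and $\boldsymbol{\beta}=(\boldsymbol{\pi},\boldsymbol{0},\dots,\boldsymbol{0})$. Let $\boldsymbol{X}=(X_1,\dots,X_n)$ be a random vector in $\mathbb{R}_+^n$ with joint Laplace transform, for $\boldsymbol{u}\in\mathbb{R}_+^n$, $$L_{\boldsymbol{X}}(\boldsymbol{u})=\boldsymbol{\beta}\begin{pmatrix}u_1^{\alpha_1}\boldsymbol{I}-\boldsymbol{C}_1&-\boldsymbol{D}_1&\boldsymbol{0}&\cdots&\boldsymbol{0}\\ \boldsymbol{0}&u_2^{\alpha_2}\boldsymbol{I}-\boldsymbol{C}_2&-\boldsymbol{D}_2&\cdots&\boldsymbol{0}\\ \boldsymbol{0}&\boldsymbol{0}&u_3^{\alpha_3}\boldsymbol{I}-\boldsymbol{C}_3&\cdots&\boldsymbol{0}\\ \vdots&\vdots&\vdots&\ddots&\vdots\\ \boldsymbol{0}&\boldsymbol{0}&\boldsymbol{0}&\cdots&u_n^{\alpha_n}\boldsymbol{I}-\boldsymbol{C}_n\end{pmatrix}^{-1}\begin{pmatrix}\boldsymbol{0}\\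 \boldsymbol{0}\\ \boldsymbol{0}\\ \vdots\\ \boldsymbol{D}_n\boldsymbol{e}\end{pmatrix}.$$ Then this Laplace transform can equivalently be written as $$L_{\boldsymbol{X}}(\boldsymbol{u})=\boldsymbol{\pi}\left(\prod_{i=1}^n(u_i^{\alpha_i}\boldsymbol{I}-\boldsymbol{C}_i)^{-1}\boldsymbol{D}_i\right)\boldsymbol{e},\qquad\boldsymbol{u}\in\mathbb{R}_+^n.$$ The corresponding joint density is given by $$f_{\boldsymbol{X}}(x_1,\dots,x_n)=\boldsymbol{\pi}\left(\prod_{i=1}^n x_i^{\alpha_i-1}E_{\alpha_i,\alpha_i}(\boldsymbol{C}_ix_i^{\alpha_i})\boldsymbol{D}_i\right)\boldsymbol{e},\qquad x_i>0,\ i=1,\dots,n.$$ For each $i=1,\dots,n$, the $i$-th marginal satisfies $$X_i\sim\mathrm{MML}(\alpha_i,\boldsymbol{\beta}_i,\boldsymbol{C}_i),\qquad\text{where}\quad \boldsymbol{\beta}_i=\boldsymbol{\pi}\prod_{j=1}^{i-1}(-\boldsymbol{C}_j)^{-1}\boldsymbol{D}_j.$$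
   Context: $\mathbb{R}_+=[0,\infty)$. A $p\times p$ sub-intensity matrix is the restriction to the transient states $1,\dots,p$ of the intensity matrix of a Markov jump process on $\{1,\dots,p,p+1\}$ in which $1,\dots,p$ are transient and $p+1$ is absorbing (off-diagonal entries nonnegative, row sums nonpositive, invertible; all eigenvalues have strictly negative real part). $\boldsymbol{e}$ denotes a column vector of ones of the appropriate dimension. Products of matrices $\prod_{i=1}^n\boldsymbol{A}_i$ are ordered $\boldsymbol{A}_1\boldsymbol{A}_2\cdots\boldsymbol{A}_n$; an empty product is the identity. The Mittag-Leffler function of a square matrix $\boldsymbol{A}$ is $E_{\alpha,\beta}(\boldsymbol{A})=\sum_{k=0}^\infty\frac{\boldsymbol{A}^k}{\Gamma(\alpha k+\beta)}$. For $0<\alpha\le1$, a probability row vector $\boldsymbol{\pi}$ and a sub-intensity matrix $\boldsymbol{T}$, a random variable $X\geq 0$ has the matrix Mittag-Leffler distribution $\mathrm{MML}(\alpha,\boldsymbol{\pi},\boldsymbol{T})$ if $\mathbb{E}(e^{-uX})=\boldsymbol{\pi}(u^\alpha\boldsymbol{I}-\boldsymbol{T})^{-1}\boldsymbol{t}$ for $u\ge0$, with $\boldsymbol{t}=-\boldsymbol{T}\boldsymbol{e}$; equivalently, $X$ has density $x^{\alpha-1}\boldsymbol{\pi}E_{\alpha,\alpha}(\boldsymbol{T}x^\alpha)\boldsymbol{t}$ on $(0,\infty)$. *)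

theory Defs
  imports
    "HOL-Probability.Probability"
    "Jordan_Normal_Form.Gauss_Jordan_Elimination"
    "Jordan_Normal_Form.Determinant"
begin

unbundle no inner_syntax
unbundle no vec_syntax

text \<open>Row and column vectors both have type \<^typ>\<open>real vec\<close>; a row vector times a
  column vector is the scalar product.\<close>

definition ones :: "nat \<Rightarrow> real vec" where
  "ones k = vec k (\<lambda>_. 1)"

text \<open>The value is unspecified unless the argument is an invertible square matrix.\<close>

definition mat_inv :: "real mat \<Rightarrow> real mat" where
  "mat_inv A = the (mat_inverse A)"

lemma mat_inv_eqI:
  assumes A: "A \<in> carrier_mat k k" and B: "B \<in> carrier_mat k k" and AB: "A * B = 1\<^sub>m k"
  shows "mat_inv A = B"
proof -
  have BA: "B * A = 1\<^sub>m k"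
    using mat_mult_left_right_inverse[OF A B AB] .
  have "A \<in> Units (ring_mat TYPE(real) k ())"
    using A B AB BA by (auto simp: Units_def ring_mat_def)
  then obtain C where C: "mat_inverse A = Some C"
    using mat_inverse(1)[OF A, where b = "()"] by (cases "mat_inverse A") blast+
  have CA: "C * A = 1\<^sub>m k" and C': "C \<in> carrier_mat k k"
    using mat_inverse(2)[OF A C] by auto
  have "C = C * (A * B)"
    using AB C' by simp
  also have "\<dots> = (C * A) * B"
    by (rule assoc_mult_mat[OF C' A B, symmetric])
  also have "\<dots> = B"
    using CA B by simp
  finally show ?thesis
    by (simp add: mat_inv_def C)
qed

definition row_mult :: "real vec \<Rightarrow> real mat \<Rightarrow> real vec" where
  "row_mult v A = vec (dim_col A) (\<lambda>j. v \<bullet> col A j)"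

text \<open>\<open>mat_prod d A m\<close> is the ordered product \<open>A 1 * A 2 * \<dots> * A m\<close>, where \<open>d\<close> is the
  number of rows of \<open>A 1\<close>, so that the empty product is the identity of dimension \<open>d\<close>.\<close>

primrec mat_prod :: "nat \<Rightarrow> (nat \<Rightarrow> real mat) \<Rightarrow> nat \<Rightarrow> real mat" where
  "mat_prod d A 0 = 1\<^sub>m d"
| "mat_prod d A (Suc m) = mat_prod d A m * A (Suc m)"

text \<open>Block vectors and block matrices with blocks numbered \<open>1, \<dots>, n\<close>, the \<open>i\<close>-th one of
  size \<open>p i\<close>. Library vectors and matrices are indexed from \<open>0\<close>, so the \<open>i\<close>-th block occupies
  the indices \<open>r\<close> with \<open>p 1 + \<dots> + p (i - 1) \<le> r < p 1 + \<dots> + p i\<close>.\<close>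

definition block_of :: "(nat \<Rightarrow> nat) \<Rightarrow> nat \<Rightarrow> nat" where
  "block_of p r = (LEAST i. r < (\<Sum>j=1..i. p j))"

definition offset_of :: "(nat \<Rightarrow> nat) \<Rightarrow> nat \<Rightarrow> nat" where
  "offset_of p r = r - (\<Sum>j=1..<block_of p r. p j)"

definition block_vec :: "nat \<Rightarrow> (nat \<Rightarrow> nat) \<Rightarrow> (nat \<Rightarrow> real vec) \<Rightarrow> real vec" where
  "block_vec n p v = vec (\<Sum>j=1..n. p j) (\<lambda>r. v (block_of p r) $ offset_of p r)"

definition block_mat ::
    "nat \<Rightarrow> (nat \<Rightarrow> nat) \<Rightarrow> (nat \<Rightarrow> nat \<Rightarrow> real mat) \<Rightarrow> real mat" where
  "block_mat n p B = mat (\<Sum>j=1..n. p j) (\<Sum>j=1..n. p j)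
     (\<lambda>(r, c). B (block_of p r) (block_of p c) $$ (offset_of p r, offset_of p c))"

text \<open>Since off-diagonal entries are nonnegative and row sums are nonpositive, invertibility is
  equivalent to transience of all states, and to all eigenvalues having strictly negative real
  part.\<close>

definition sub_intensity :: "nat \<Rightarrow> real mat \<Rightarrow> bool" where
  "sub_intensity p T \<longleftrightarrow> T \<in> carrier_mat p p
     \<and> (\<forall>i<p. \<forall>j<p. i \<noteq> j \<longrightarrow> 0 \<le> T $$ (i, j))
     \<and> (\<forall>i<p. (\<Sum>j<p. T $$ (i, j)) \<le> 0)
     \<and> invertible_mat T"

definition prob_vec :: "nat \<Rightarrow> real vec \<Rightarrow> bool" where
  "prob_vec p v \<longleftrightarrow> v \<in> carrier_vec p \<and> (\<forall>i<p. 0 \<le> v $ i) \<and> (\<Sum>i<p. v $ i) = 1"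

definition nonneg_mat :: "real mat \<Rightarrow> bool" where
  "nonneg_mat A \<longleftrightarrow> (\<forall>i<dim_row A. \<forall>j<dim_col A. 0 \<le> A $$ (i, j))"

definition mittag_leffler :: "real \<Rightarrow> real \<Rightarrow> real mat \<Rightarrow> real mat" where
  "mittag_leffler a b A = mat (dim_row A) (dim_col A)
     (\<lambda>(i, j). \<Sum>k. (A ^\<^sub>m k) $$ (i, j) / Gamma (a * real k + b))"

text \<open>The matrix \<open>u\<^sup>a I - T\<close>. Note that \<open>0 powr a = 0\<close>.\<close>

definition resolvent_mat :: "real \<Rightarrow> real \<Rightarrow> real mat \<Rightarrow> real mat" where
  "resolvent_mat u a T = (u powr a) \<cdot>\<^sub>m 1\<^sub>m (dim_row T) - T"

definition joint_laplace ::
    "'w measure \<Rightarrow> nat \<Rightarrow> (nat \<Rightarrow> 'w \<Rightarrow> real) \<Rightarrow> (nat \<Rightarrow> real) \<Rightarrow> real" where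
  "joint_laplace M n X u = (\<integral>\<omega>. exp (- (\<Sum>i=1..n. u i * X i \<omega>)) \<partial>M)"

definition mml :: "'w measure \<Rightarrow> ('w \<Rightarrow> real) \<Rightarrow> real \<Rightarrow> real vec \<Rightarrow> real mat \<Rightarrow> bool" where
  "mml M X a v T \<longleftrightarrow>
     X \<in> borel_measurable M \<and> (\<forall>\<omega>\<in>space M. 0 \<le> X \<omega>)
     \<and> 0 < a \<and> a \<le> 1 \<and> prob_vec (dim_vec v) v \<and> sub_intensity (dim_vec v) T
     \<and> (\<forall>u\<ge>0. (\<integral>\<omega>. exp (- (u * X \<omega>)) \<partial>M)
          = v \<bullet> (mat_inv (resolvent_mat u a T) *\<^sub>v (- (T *\<^sub>v ones (dim_vec v)))))"

text \<open>The random vector \<open>(X 1, \<dots>, X n)\<close>, with values in \<open>[0, \<infinity>)\<^sup>n\<close>, has joint density \<open>f\<close> on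
  \<open>(0, \<infinity>)\<^sup>n\<close>. Nonnegativity of \<open>f\<close> is required explicitly because \<^const>\<open>ennreal\<close> truncates
  negative values to \<open>0\<close>.\<close>

definition has_joint_density ::
    "'w measure \<Rightarrow> nat \<Rightarrow> (nat \<Rightarrow> 'w \<Rightarrow> real) \<Rightarrow> ((nat \<Rightarrow> real) \<Rightarrow> real) \<Rightarrow> bool" where
  "has_joint_density M n X f \<longleftrightarrow>
     (\<forall>x. (\<forall>i\<in>{1..n}. 0 < x i) \<longrightarrow> 0 \<le> f x)
     \<and> distributed M (\<Pi>\<^sub>M i\<in>{1..n}. lborel) (\<lambda>\<omega>. \<lambda>i\<in>{1..n}. X i \<omega>)
         (\<lambda>x. if \<forall>i\<in>{1..n}. 0 < x i then ennreal (f x) else 0)"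

end

theory Submission
  imports Defs
begin

text \<open>
  The joint law of \<open>X\<close> has Laplace transform \<open>v R\<^sub>1(u\<^sub>1) D\<^sub>1 \<dots> R\<^sub>n(u\<^sub>n) D\<^sub>n e\<close> with resolvents
  \<open>R\<^sub>i(u) = (u\<^sup>\<alpha> I - C\<^sub>i)\<^sup>-\<^sup>1\<close>, where \<open>v\<close> is the initial row vector. Everything follows from
  the fact that each coordinate enters through a factor of its own.

  \<^item> \<^bold>\<open>Product form.\<close> The block matrix is upper bidiagonal, so the linear system is solved by back
    substitution: the blocks of the solution satisfy \<open>w\<^sub>i = R\<^sub>i(u\<^sub>i) D\<^sub>i w\<^sub>i\<^sub>+\<^sub>1\<close>, starting from
    \<open>w\<^sub>n\<^sub>+\<^sub>1 = e\<close> (\<open>block_bidiagonal_solution\<close>, \<open>block_laplace_eq_product\<close>). For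
    \<open>u > 0\<close> the resolvents exist by a minimum principle (\<open>sub_intensity_minimum_principle\<close>), for
    \<open>u = 0\<close> by the invertibility of \<open>C\<^sub>i\<close>.

  \<^item> \<^bold>\<open>Density.\<close> Integrating the power series of \<open>x\<^sup>\<alpha>\<^sup>-\<^sup>1 E(C x\<^sup>\<alpha>)\<close> term by term against
    \<open>exp (- u x)\<close> gives the Neumann series of \<open>(u\<^sup>\<alpha> I - C)\<^sup>-\<^sup>1\<close> as soon as \<open>u\<close> is large
    (\<open>laplace_mittag_leffler_entry\<close>). By Fubini the claimed density \<open>f\<close> then has the Laplace transform of
    \<open>X\<close> for all large arguments (\<open>laplace_density_fun\<close>). At this point \<open>f\<close> is only a signed
    function, integrable after multiplication with \<open>exp (- c (x\<^sub>1 + \<dots> + x\<^sub>n))\<close>. Laplace transforms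
    determine signed weights as well (\<open>laplace_transform_determines_integrals\<close>), hence \<open>f\<close> integrates
    over every set to the probability of that set, up to the exponential tilt. So \<open>f\<close> is nonnegative almost
    everywhere because the law of \<open>X\<close> is, and nonnegative everywhere by continuity
    (\<open>density_of_laplace_transform\<close>).

  \<^item> \<^bold>\<open>Marginals.\<close> Putting \<open>u\<^sub>j = 0\<close> for \<open>j \<noteq> i\<close> turns the factors after the \<open>i\<close>-th
    into the stochastic matrices \<open>(- C\<^sub>j)\<^sup>-\<^sup>1 D\<^sub>j\<close>, which fix \<open>e\<close> and disappear, while those before it
    make up the initial vector (\<open>product_at_single_coordinate\<close>). This vector is a probability vector
    since \<open>(- C\<^sub>j)\<^sup>-\<^sup>1\<close> has nonnegative entries (\<open>uminus_sub_intensity_inverse_nonneg\<close>).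
\<close>

section \<open>Laplace transforms determine signed weights\<close>

lemma integrable_mult_bounded_on_support:
  fixes U r :: "'z \<Rightarrow> real"
  assumes U: "integrable \<kappa> U" and r [measurable]: "r \<in> borel_measurable \<kappa>"
    and bound: "\<And>x. x \<in> space \<kappa> \<Longrightarrow> U x \<noteq> 0 \<Longrightarrow> \<bar>r x\<bar> \<le> B"
  shows "integrable \<kappa> (\<lambda>x. U x * r x)"
proof (rule Bochner_Integration.integrable_bound[of _ "\<lambda>x. B * U x"])
  note [measurable] = borel_measurable_integrable[OF U]
  show "(\<lambda>x. U x * r x) \<in> borel_measurable \<kappa>" by measurable
  show "AE x in \<kappa>. norm (U x * r x) \<le> norm (B * U x)"
  proof (rule AE_I2)
    fix x assume "x \<in> space \<kappa>"
    then show "norm (U x * r x) \<le> norm (B * U x)"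
      using bound[of x]
      by (cases "U x = 0") (auto simp: abs_mult mult.commute[of "\<bar>U x\<bar>"] intro!: mult_right_mono)
  qed
qed (use U in simp)

text \<open>
  A Dynkin class argument for two weights on two spaces. The weights may be signed, so the two sides are
  integrals rather than measures, and the total masses have to be matched separately to handle complements.
\<close>

lemma integral_indicator_vimage_eq_by_generator:
  fixes V :: "'a \<Rightarrow> real" and W :: "'b \<Rightarrow> real"
  assumes V: "integrable \<mu> V" and W: "integrable \<nu> W"
    and Y [measurable]: "Y \<in> measurable \<mu> N" and Z [measurable]: "Z \<in> measurable \<nu> N"
    and E: "Int_stable E" "E \<subseteq> Pow (space N)" "sets N = sigma_sets (space N) E"
    and eqE: "\<And>A. A \<in> E \<Longrightarrow>
      (\<integral>x. V x * indicator A (Y x) \<partial>\<mu>) = (\<integral>x. W x * indicator A (Z x) \<partial>\<nu>)"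
    and total: "(\<integral>x. V x \<partial>\<mu>) = (\<integral>x. W x \<partial>\<nu>)"
    and A: "A \<in> sets N"
  shows "(\<integral>x. V x * indicator A (Y x) \<partial>\<mu>) = (\<integral>x. W x * indicator A (Z x) \<partial>\<nu>)"
proof -
  note [measurable] = borel_measurable_integrable[OF V] borel_measurable_integrable[OF W]
  have ind_compl: "(\<integral>x. U x * indicator (space N - B) (T x) \<partial>\<kappa>)
      = (\<integral>x. U x \<partial>\<kappa>) - (\<integral>x. U x * indicator B (T x) \<partial>\<kappa>)"
    if U: "integrable \<kappa> U" and T: "T \<in> measurable \<kappa> N" and B: "B \<in> sets N"
    for \<kappa> :: "'z measure" and U :: "'z \<Rightarrow> real" and T B
  proof -
    have "(\<integral>x. U x * indicator (space N - B) (T x) \<partial>\<kappa>)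
      = (\<integral>x. U x - U x * indicator B (T x) \<partial>\<kappa>)"
      using measurable_space[OF T] by (intro Bochner_Integration.integral_cong) (auto simp: indicator_def)
    also have "\<dots> = (\<integral>x. U x \<partial>\<kappa>) - (\<integral>x. U x * indicator B (T x) \<partial>\<kappa>)"
      using T B
      by (intro Bochner_Integration.integral_diff[OF U] integrable_mult_bounded_on_support[OF U, of _ 1])
        (auto simp: indicator_def)
    finally show ?thesis .
  qed
  have ind_union: "(\<integral>x. U x * indicator (\<Union>i. B i) (T x) \<partial>\<kappa>)
      = (\<Sum>i. \<integral>x. U x * indicator (B i) (T x) \<partial>\<kappa>)"
    if U: "integrable \<kappa> U" and T: "T \<in> measurable \<kappa> N"
      and B: "\<And>i. B i \<in> sets N" and d: "disjoint_family B"
    for \<kappa> :: "'z measure" and U :: "'z \<Rightarrow> real" and T and B :: "nat \<Rightarrow> _"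
  proof -
    let ?C = "\<lambda>i. T -` B i \<inter> space \<kappa>"
    have "(LINT x:(\<Union>i. ?C i)|\<kappa>. U x) = (\<Sum>i. LINT x:?C i|\<kappa>. U x)"
    proof (rule lebesgue_integral_countable_add)
      show Ci: "?C i \<in> sets \<kappa>" for i using T B by measurable
      show "?C i \<inter> ?C j = {}" if "i \<noteq> j" for i j
        using d that by (auto simp: disjoint_family_on_def)
      show "set_integrable \<kappa> (\<Union>i. ?C i) U"
        unfolding set_integrable_def
        by (intro integrable_mult_indicator U sets.countable_UN) (use Ci in auto)
    qed
    moreover have "(LINT x:(\<Union>i. ?C i)|\<kappa>. U x) = (\<integral>x. U x * indicator (\<Union>i. B i) (T x) \<partial>\<kappa>)"
      unfolding set_lebesgue_integral_def
      by (intro Bochner_Integration.integral_cong) (auto simp: indicator_def)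
    moreover have "(LINT x:?C i|\<kappa>. U x) = (\<integral>x. U x * indicator (B i) (T x) \<partial>\<kappa>)" for i
      unfolding set_lebesgue_integral_def
      by (intro Bochner_Integration.integral_cong) (auto simp: indicator_def)
    ultimately show ?thesis by simp
  qed
  have "A \<in> sigma_sets (space N) E" using A E by simp
  then show ?thesis
  proof (induction rule: sigma_sets_induct_disjoint
      [OF E(1,2), consumes 1, case_names basic empty compl union])
    case (basic A) then show ?case by (rule eqE)
  next
    case empty show ?case by simp
  next
    case (compl A)
    then have "A \<in> sets N" by (simp add: E(3))
    then show ?case
      using total compl.IH by (simp add: ind_compl[OF V Y] ind_compl[OF W Z])
  next
    case (union B)
    then have "B i \<in> sets N" for i using E(3) by auto
    then show ?case
      using union by (simp add: ind_union[OF V Y] ind_union[OF W Z])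
  qed
qed

text \<open>
  The moment problem on the unit interval is determinate: by Weierstrass approximation equal moments give
  equal integrals of continuous functions, indicators of open half-lines are bounded limits of these, and the
  half-lines generate the Borel sets.
\<close>

lemma integral_indicator_eq_by_moments:
  fixes V Y :: "'a \<Rightarrow> real" and W Z :: "'b \<Rightarrow> real"
  assumes V: "integrable \<mu> V" and W: "integrable \<nu> W"
    and Y [measurable]: "Y \<in> borel_measurable \<mu>" and Z [measurable]: "Z \<in> borel_measurable \<nu>"
    and Y01: "\<And>x. x \<in> space \<mu> \<Longrightarrow> V x \<noteq> 0 \<Longrightarrow> Y x \<in> {0..1}"
    and Z01: "\<And>x. x \<in> space \<nu> \<Longrightarrow> W x \<noteq> 0 \<Longrightarrow> Z x \<in> {0..1}"
    and moments: "\<And>k::nat. (\<integral>x. V x * Y x ^ k \<partial>\<mu>) = (\<integral>x. W x * Z x ^ k \<partial>\<nu>)"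
    and A: "A \<in> sets borel"
  shows "(\<integral>x. V x * indicator A (Y x) \<partial>\<mu>) = (\<integral>x. W x * indicator A (Z x) \<partial>\<nu>)"
proof -
  have poly: "(\<integral>x. V x * q (Y x) \<partial>\<mu>) = (\<integral>x. W x * q (Z x) \<partial>\<nu>)"
    if qp: "real_polynomial_function q" for q :: "real \<Rightarrow> real"
  proof -
    obtain a n where q: "q = (\<lambda>x. \<Sum>i\<le>n. a i * x ^ i)"
      using qp unfolding real_polynomial_function_iff_sum by blast
    have expand: "(\<integral>x. U x * q (T x) \<partial>\<kappa>) = (\<Sum>i\<le>n. a i * (\<integral>x. U x * T x ^ i \<partial>\<kappa>))"
      if U: "integrable \<kappa> U" and T: "T \<in> borel_measurable \<kappa>"
      and T01: "\<And>x. x \<in> space \<kappa> \<Longrightarrow> U x \<noteq> 0 \<Longrightarrow> T x \<in> {0..1}"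
      for \<kappa> :: "'c measure" and U T :: "'c \<Rightarrow> real"
    proof -
      have "integrable \<kappa> (\<lambda>x. U x * T x ^ i)" for i
        using T T01
        by (intro integrable_mult_bounded_on_support[OF U, of _ 1]) (auto simp: power_abs power_le_one)
      then have "(\<integral>x. (\<Sum>i\<le>n. a i * (U x * T x ^ i)) \<partial>\<kappa>) = (\<Sum>i\<le>n. a i * (\<integral>x. U x * T x ^ i \<partial>\<kappa>))"
        by (subst Bochner_Integration.integral_sum) auto
      then show ?thesis by (simp add: q sum_distrib_left mult_ac)
    qed
    show ?thesis
      by (simp add: expand[OF V Y Y01] expand[OF W Z Z01] moments)
  qed
  have cont: "(\<integral>x. V x * h (Y x) \<partial>\<mu>) = (\<integral>x. W x * h (Z x) \<partial>\<nu>)"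
    if h: "continuous_on UNIV h" for h :: "real \<Rightarrow> real"
  proof -
    have hm [measurable]: "h \<in> borel_measurable borel"
      using h by (rule borel_measurable_continuous_onI)
    have h01: "continuous_on {0..1} h" using h continuous_on_subset by blast
    define K where "K = (\<integral>x. \<bar>V x\<bar> \<partial>\<mu>) + (\<integral>x. \<bar>W x\<bar> \<partial>\<nu>)"
    have "\<bar>(\<integral>x. V x * h (Y x) \<partial>\<mu>) - (\<integral>x. W x * h (Z x) \<partial>\<nu>)\<bar> \<le> e * K" if e: "e > 0" for e
    proof -
      obtain q where q: "real_polynomial_function q" "\<And>t. t \<in> {0..1} \<Longrightarrow> \<bar>h t - q t\<bar> < e"
        using Stone_Weierstrass_real_polynomial_function[OF compact_Icc h01 e] by metis
      have qc: "continuous_on UNIV q"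
        using q(1) by (simp add: continuous_on_polymonial_function real_polynomial_function_eq)
      have qm: "q \<in> borel_measurable borel"
        using qc by (rule borel_measurable_continuous_onI)
      have close: "\<bar>(\<integral>x. U x * h (T x) \<partial>\<kappa>) - (\<integral>x. U x * q (T x) \<partial>\<kappa>)\<bar> \<le> e * (\<integral>x. \<bar>U x\<bar> \<partial>\<kappa>)"
        if U: "integrable \<kappa> U" and T: "T \<in> borel_measurable \<kappa>"
          and T01: "\<And>x. x \<in> space \<kappa> \<Longrightarrow> U x \<noteq> 0 \<Longrightarrow> T x \<in> {0..1}"
        for \<kappa> :: "'c measure" and U T :: "'c \<Rightarrow> real"
      proof -
        obtain B where B: "\<And>t. t \<in> {0..1} \<Longrightarrow> \<bar>h t\<bar> \<le> B"
          using compact_imp_bounded[OF compact_continuous_image[OF h01 compact_Icc]]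
          unfolding bounded_iff by (metis imageI real_norm_def)
        have qB: "\<bar>q t\<bar> \<le> B + e" if "t \<in> {0..1}" for t
          using B[OF that] q(2)[OF that] by linarith
        have ih: "integrable \<kappa> (\<lambda>x. U x * h (T x))" 
          by (rule integrable_mult_bounded_on_support[OF U measurable_compose[OF T hm] B[OF T01]])
        have iq: "integrable \<kappa> (\<lambda>x. U x * q (T x))" 
          by (rule integrable_mult_bounded_on_support[OF U measurable_compose[OF T qm] qB[OF T01]])
        have "\<bar>(\<integral>x. U x * h (T x) \<partial>\<kappa>) - (\<integral>x. U x * q (T x) \<partial>\<kappa>)\<bar>
            = \<bar>\<integral>x. U x * h (T x) - U x * q (T x) \<partial>\<kappa>\<bar>"
          using ih iq by simp
        also have "\<dots> \<le> (\<integral>x. \<bar>U x * h (T x) - U x * q (T x)\<bar> \<partial>\<kappa>)"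
          by (rule integral_abs_bound)
        also have "\<dots> \<le> (\<integral>x. e * \<bar>U x\<bar> \<partial>\<kappa>)"
        proof (rule integral_mono)
          show "integrable \<kappa> (\<lambda>x. \<bar>U x * h (T x) - U x * q (T x)\<bar>)"
            using ih iq by auto
          show "integrable \<kappa> (\<lambda>x. e * \<bar>U x\<bar>)" using U by simp
          fix x assume x: "x \<in> space \<kappa>"
          show "\<bar>U x * h (T x) - U x * q (T x)\<bar> \<le> e * \<bar>U x\<bar>"
          proof (cases "U x = 0")
            case False
            then have "\<bar>h (T x) - q (T x)\<bar> \<le> e" using T01[OF x] q(2)[of "T x"] by simp
            then show ?thesis
              by (simp add: abs_mult mult_right_mono mult.commute[of _ "\<bar>U x\<bar>"] mult_left_mono
                  flip: right_diff_distrib)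
          qed simp
        qed
        finally show ?thesis by simp
      qed
      show ?thesis
        using close[OF V Y Y01] close[OF W Z Z01] poly[OF q(1)]
        by (simp add: K_def distrib_left)
    qed
    moreover have "K \<ge> 0" by (auto simp: K_def intro!: add_nonneg_nonneg)
    ultimately have "\<bar>(\<integral>x. V x * h (Y x) \<partial>\<mu>) - (\<integral>x. W x * h (Z x) \<partial>\<nu>)\<bar> \<le> 0 + e"
      if "e > 0" for e
    proof -
      have "e / (K + 1) * K \<le> e"
        using \<open>K \<ge> 0\<close> \<open>e > 0\<close> by (simp add: field_simps)
      moreover have "e / (K + 1) > 0" using \<open>K \<ge> 0\<close> \<open>e > 0\<close> by simp
      ultimately show ?thesis
        using \<open>\<And>e. 0 < e \<Longrightarrow> \<bar>(\<integral>x. V x * h (Y x) \<partial>\<mu>) - (\<integral>x. W x * h (Z x) \<partial>\<nu>)\<bar> \<le> e * K\<close>[of "e / (K + 1)"]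
        by linarith
    qed
    from field_le_epsilon[OF this] show ?thesis by simp
  qed
  have halfline: "(\<integral>x. V x * indicator {s<..} (Y x) \<partial>\<mu>) = (\<integral>x. W x * indicator {s<..} (Z x) \<partial>\<nu>)" for s
  proof -
    \<comment> \<open>steeper and steeper ramps that start at \<open>s\<close>\<close>
    define h :: "nat \<Rightarrow> real \<Rightarrow> real" where "h m y = min 1 (max 0 (real m * (y - s)))" for m y
    have h01: "0 \<le> h m y" "h m y \<le> 1" for m y by (auto simp: h_def)
    have hc: "continuous_on UNIV (h m)" for m unfolding h_def by (intro continuous_intros)
    have lim: "(\<lambda>m. h m y) \<longlonglongrightarrow> indicator {s<..} y" for y
    proof (cases "y > s")
      case True
      have "eventually (\<lambda>m. real m * (y - s) \<ge> 1) sequentially"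
        using True by real_asymp
      then have "eventually (\<lambda>m. h m y = 1) sequentially"
        by eventually_elim (auto simp: h_def)
      then show ?thesis using True by (simp add: tendsto_eventually)
    next
      case False
      then have "h m y = 0" for m by (auto simp: h_def mult_nonneg_nonpos)
      then show ?thesis using False by simp
    qed
    have conv: "(\<lambda>m. \<integral>x. U x * h m (T x) \<partial>\<kappa>) \<longlonglongrightarrow> (\<integral>x. U x * indicator {s<..} (T x) \<partial>\<kappa>)"
      if U: "integrable \<kappa> U" and T: "T \<in> borel_measurable \<kappa>"
      for \<kappa> :: "'c measure" and U T :: "'c \<Rightarrow> real"
    proof (rule integral_dominated_convergence[where w="\<lambda>x. \<bar>U x\<bar>"])
      note [measurable] = T borel_measurable_integrable[OF U]
        borel_measurable_continuous_onI[OF hc]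
      show "(\<lambda>x. U x * indicator {s<..} (T x)) \<in> borel_measurable \<kappa>" by measurable
      show "(\<lambda>x. U x * h m (T x)) \<in> borel_measurable \<kappa>" for m by measurable
      show "integrable \<kappa> (\<lambda>x. \<bar>U x\<bar>)" using U by simp
      show "AE x in \<kappa>. (\<lambda>m. U x * h m (T x)) \<longlonglongrightarrow> U x * indicator {s<..} (T x)"
        by (auto intro!: tendsto_mult lim)
      show "AE x in \<kappa>. norm (U x * h m (T x)) \<le> \<bar>U x\<bar>" for m
        using h01 by (auto simp: abs_mult intro!: mult_left_le)
    qed
    show ?thesis
      using LIMSEQ_unique[OF conv[OF V Y]] conv[OF W Z] cont[OF hc] by simp
  qed
  show ?thesis
  proof (rule integral_indicator_vimage_eq_by_generator[OF V W Y Z, of "range greaterThan"])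
    show "Int_stable (range (greaterThan :: real \<Rightarrow> _))"
    proof (rule Int_stableI)
      fix a b :: "real set" assume "a \<in> range greaterThan" "b \<in> range greaterThan"
      then obtain x y where "a = {x<..}" "b = {y<..}" by auto
      then have "a \<inter> b = {max x y<..}" by auto
      then show "a \<inter> b \<in> range greaterThan" by auto
    qed
    show "sets (borel::real measure) = sigma_sets (space borel) (range greaterThan)"
      by (subst borel_Ioi) (simp add: sets_measure_of)
  qed (use halfline moments[of 0] A in auto)
qed

text \<open>
  The values of a Laplace transform at the natural numbers are the moments of \<open>exp (- Y)\<close>, which takes
  values in the unit interval.
\<close>

lemma integral_indicator_eq_by_laplace:
  fixes V Y :: "'a \<Rightarrow> real" and W Z :: "'b \<Rightarrow> real"
  assumes V: "integrable \<mu> V" and W: "integrable \<nu> W"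
    and Y [measurable]: "Y \<in> borel_measurable \<mu>" and Z [measurable]: "Z \<in> borel_measurable \<nu>"
    and Y0: "\<And>x. x \<in> space \<mu> \<Longrightarrow> V x \<noteq> 0 \<Longrightarrow> 0 \<le> Y x"
    and Z0: "\<And>x. x \<in> space \<nu> \<Longrightarrow> W x \<noteq> 0 \<Longrightarrow> 0 \<le> Z x"
    and laplace: "\<And>k::nat.
      (\<integral>x. V x * exp (- (real k * Y x)) \<partial>\<mu>) = (\<integral>x. W x * exp (- (real k * Z x)) \<partial>\<nu>)"
    and A [measurable]: "A \<in> sets borel"
  shows "(\<integral>x. V x * indicator A (Y x) \<partial>\<mu>) = (\<integral>x. W x * indicator A (Z x) \<partial>\<nu>)"
proof -
  \<comment> \<open>the image of \<open>A\<close> under \<open>y \<mapsto> exp (- y)\<close>\<close>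
  let ?B = "{y. 0 < y \<and> - ln y \<in> A}"
  have "(\<integral>x. V x * indicator ?B (exp (- Y x)) \<partial>\<mu>) = (\<integral>x. W x * indicator ?B (exp (- Z x)) \<partial>\<nu>)"
  proof (rule integral_indicator_eq_by_moments[OF V W])
    show "(\<integral>x. V x * exp (- Y x) ^ k \<partial>\<mu>) = (\<integral>x. W x * exp (- Z x) ^ k \<partial>\<nu>)" for k
      using laplace[of k] by (simp flip: exp_of_nat_mult)
    have "Measurable.pred borel (\<lambda>y::real. 0 < y \<and> - ln y \<in> A)" by measurable
    then show "?B \<in> sets borel" by simp
  qed (use Y0 Z0 in auto)
  moreover have "indicator ?B (exp (- y)) = (indicator A y :: real)" for y
    by (simp add: indicator_def)
  ultimately show ?thesis by simp
qed

text \<open>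
  Uniqueness of multivariate Laplace transforms, deduced from the one-dimensional case by converting the
  exponential factors into indicators one coordinate at a time: with all other factors frozen into the weight,
  the integral is a univariate Laplace transform in the coordinate under consideration.
\<close>

theorem laplace_transform_determines_integrals:
  fixes V :: "'a \<Rightarrow> real" and Y :: "'i \<Rightarrow> 'a \<Rightarrow> real"
    and W :: "'b \<Rightarrow> real" and Z :: "'i \<Rightarrow> 'b \<Rightarrow> real"
  assumes I: "finite I" and V: "integrable \<mu> V" and W: "integrable \<nu> W"
    and Y [measurable]: "\<And>i. i \<in> I \<Longrightarrow> Y i \<in> borel_measurable \<mu>"
    and Z [measurable]: "\<And>i. i \<in> I \<Longrightarrow> Z i \<in> borel_measurable \<nu>"
    and Y0: "\<And>i x. i \<in> I \<Longrightarrow> x \<in> space \<mu> \<Longrightarrow> V x \<noteq> 0 \<Longrightarrow> 0 \<le> Y i x"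
    and Z0: "\<And>i x. i \<in> I \<Longrightarrow> x \<in> space \<nu> \<Longrightarrow> W x \<noteq> 0 \<Longrightarrow> 0 \<le> Z i x"
    and laplace: "\<And>k :: 'i \<Rightarrow> nat.
      (\<integral>x. V x * exp (- (\<Sum>i\<in>I. real (k i) * Y i x)) \<partial>\<mu>)
      = (\<integral>x. W x * exp (- (\<Sum>i\<in>I. real (k i) * Z i x)) \<partial>\<nu>)"
    and A: "A \<in> sets (\<Pi>\<^sub>M i\<in>I. borel)"
  shows "(\<integral>x. V x * indicator A (\<lambda>i\<in>I. Y i x) \<partial>\<mu>) = (\<integral>x. W x * indicator A (\<lambda>i\<in>I. Z i x) \<partial>\<nu>)"
proof -
  have rect: "(\<integral>x. V x * ((\<Prod>i\<in>J. indicator (B i) (Y i x)) * (\<Prod>i\<in>I - J. exp (- (real (k i) * Y i x)))) \<partial>\<mu>)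
     = (\<integral>x. W x * ((\<Prod>i\<in>J. indicator (B i) (Z i x)) * (\<Prod>i\<in>I - J. exp (- (real (k i) * Z i x)))) \<partial>\<nu>)"
    if "J \<subseteq> I" "\<And>i. i \<in> J \<Longrightarrow> B i \<in> sets borel" for J B and k :: "'i \<Rightarrow> nat"
    using finite_subset[OF that(1) I] that
  proof (induction J arbitrary: k rule: finite_induct)
    case empty
    show ?case using laplace[of k] I by (simp add: exp_sum flip: sum_negf)
  next
    case (insert j J)
    then have j: "j \<in> I" "j \<notin> J" "J \<subseteq> I" "finite J"
      and Bm [measurable]: "\<And>i. i \<in> insert j J \<Longrightarrow> B i \<in> sets borel"
      by auto
    let ?K = "I - insert j J"
    have IJ: "I - J = insert j ?K" "j \<notin> ?K" "finite ?K" using j I by auto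
    let ?rY = "\<lambda>x. (\<Prod>i\<in>J. indicator (B i) (Y i x)) * (\<Prod>i\<in>?K. exp (- (real (k i) * Y i x)))"
    let ?rZ = "\<lambda>x. (\<Prod>i\<in>J. indicator (B i) (Z i x)) * (\<Prod>i\<in>?K. exp (- (real (k i) * Z i x)))"
    have bound: "\<bar>(\<Prod>i\<in>J. indicator (B i) (t i)) * (\<Prod>i\<in>?K. exp (- (real (k i) * t i)))\<bar> \<le> 1"
      if "\<And>i. i \<in> I \<Longrightarrow> 0 \<le> t i" for t :: "'i \<Rightarrow> real"
    proof -
      have "\<bar>\<Prod>i\<in>J. indicator (B i) (t i) :: real\<bar> \<le> 1"
        by (auto simp: abs_prod intro!: prod_le_1)
      moreover have "\<bar>\<Prod>i\<in>?K. exp (- (real (k i) * t i))\<bar> \<le> 1"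
        using that by (auto simp: abs_prod intro!: prod_le_1)
      ultimately show ?thesis
        unfolding abs_mult by (intro mult_le_one) auto
    qed
    have "(\<integral>x. (V x * ?rY x) * indicator (B j) (Y j x) \<partial>\<mu>)
        = (\<integral>x. (W x * ?rZ x) * indicator (B j) (Z j x) \<partial>\<nu>)"
    proof (rule integral_indicator_eq_by_laplace)
      show "integrable \<mu> (\<lambda>x. V x * ?rY x)"
      proof (rule integrable_mult_bounded_on_support[OF V, of _ 1])
        show "?rY \<in> borel_measurable \<mu>"
        proof (intro borel_measurable_times borel_measurable_prod)
          fix i
          show "(\<lambda>x. indicator (B i) (Y i x)) \<in> borel_measurable \<mu>" if "i \<in> J"
            using that j(3) by (intro measurable_compose[OF Y borel_measurable_indicator] Bm) auto
          show "(\<lambda>x. exp (- (real (k i) * Y i x))) \<in> borel_measurable \<mu>" if "i \<in> ?K"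
            by (rule measurable_compose[OF Y]) (use that in simp_all)
        qed
      qed (use Y0 in \<open>auto intro!: bound\<close>)
      show "integrable \<nu> (\<lambda>x. W x * ?rZ x)"
      proof (rule integrable_mult_bounded_on_support[OF W, of _ 1])
        show "?rZ \<in> borel_measurable \<nu>"
        proof (intro borel_measurable_times borel_measurable_prod)
          fix i
          show "(\<lambda>x. indicator (B i) (Z i x)) \<in> borel_measurable \<nu>" if "i \<in> J"
            using that j(3) by (intro measurable_compose[OF Z borel_measurable_indicator] Bm) auto
          show "(\<lambda>x. exp (- (real (k i) * Z i x))) \<in> borel_measurable \<nu>" if "i \<in> ?K"
            by (rule measurable_compose[OF Z]) (use that in simp_all)
        qed
      qed (use Z0 in \<open>auto intro!: bound\<close>)
      show "(\<integral>x. (V x * ?rY x) * exp (- (real m * Y j x)) \<partial>\<mu>)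
          = (\<integral>x. (W x * ?rZ x) * exp (- (real m * Z j x)) \<partial>\<nu>)" for m
      proof -
        have upd: "(\<Prod>i\<in>I - J. exp (- (real ((k(j := m)) i) * t i)))
            = exp (- (real m * t j)) * (\<Prod>i\<in>?K. exp (- (real (k i) * t i)))" for t :: "'i \<Rightarrow> real"
          using IJ(2,3) by (subst IJ(1)) (auto intro!: prod.cong)
        show ?thesis
          using insert.IH[of "k(j := m)"] j(3) Bm unfolding upd by (simp add: mult_ac)
      qed
    qed (use j(1) Bm Y Z Y0 Z0 in auto)
    then show ?case using j(2,4) by (simp add: mult_ac)
  qed
  show ?thesis
  proof (rule integral_indicator_vimage_eq_by_generator[OF V W _ _ Int_stable_prod_algebra])
    show "prod_algebra I (\<lambda>_. borel) \<subseteq> Pow (space (\<Pi>\<^sub>M i\<in>I. borel :: real measure))"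
      using prod_algebra_sets_into_space[of I "\<lambda>_. borel :: real measure"] by (simp add: space_PiM)
    show "sets (\<Pi>\<^sub>M i\<in>I. borel) = sigma_sets (space (\<Pi>\<^sub>M i\<in>I. borel :: real measure)) (prod_algebra I (\<lambda>_. borel))"
      by (simp add: sets_PiM space_PiM)
    show "(\<integral>x. V x \<partial>\<mu>) = (\<integral>x. W x \<partial>\<nu>)" using laplace[of "\<lambda>_. 0"] by simp
    show "A \<in> sets (\<Pi>\<^sub>M i\<in>I. borel)" by (rule A)
    fix R assume "R \<in> prod_algebra I (\<lambda>_. borel :: real measure)"
    then obtain B where R: "R = Pi\<^sub>E I B" and B: "\<And>i. i \<in> I \<Longrightarrow> B i \<in> sets borel"
      by (auto simp: prod_algebra_eq_finite[OF I])
    have "indicator R (\<lambda>i\<in>I. t i) = (\<Prod>i\<in>I. indicator (B i) (t i) :: real)" for t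
      using I by (auto simp: R indicator_def prod_zero_iff PiE_iff intro!: prod.neutral)
    then show "(\<integral>x. V x * indicator R (\<lambda>i\<in>I. Y i x) \<partial>\<mu>) = (\<integral>x. W x * indicator R (\<lambda>i\<in>I. Z i x) \<partial>\<nu>)"
      using rect[of I B] B by simp
  qed measurable
qed

section \<open>The Laplace transform of the Mittag-Leffler kernel\<close>

text \<open>
  On \<open>[R, \<infinity>)\<close> the Gamma integrand is at least \<open>R powr (z - 1) * exp (- t)\<close>. Since \<open>R\<close> is
  arbitrary, the Gamma function outgrows every geometric sequence.
\<close>

lemma Gamma_ge_powr_exp:
  fixes z R :: real
  assumes z: "z \<ge> 1" and R: "R > 0"
  shows "R powr (z - 1) * exp (- R) \<le> Gamma z"
proof (rule has_integral_le)
  show "((\<lambda>t. t powr (z - 1) / exp t) has_integral Gamma z) {0..}"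
    using z by (intro Gamma_integral_real) simp
  have "((\<lambda>t. R powr (z - 1) * exp (-1 * t)) has_integral R powr (z - 1) * (exp (-1 * R) / 1)) {R..}"
    by (intro has_integral_mult_right has_integral_exp_minus_to_infinity) simp
  then show "((\<lambda>t. if t \<in> {R..} then R powr (z - 1) * exp (-1 * t) else 0) has_integral
      R powr (z - 1) * exp (- R)) {0..}"
    using R by (subst has_integral_restrict) auto
  show "(if t \<in> {R..} then R powr (z - 1) * exp (-1 * t) else 0) \<le> t powr (z - 1) / exp t"
    if "t \<in> {0..}" for t
    using z R by (auto simp: exp_minus field_simps powr_mono2)
qed

lemma laplace_powr:
  fixes z u :: real
  assumes z: "z > 0" and u: "u > 0"
  shows "has_bochner_integral lborel (\<lambda>t. indicator {0<..} t * (exp (- (u * t)) * t powr (z - 1))) (Gamma z / u powr z)"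
proof (rule has_bochner_integral_nn_integral)
  let ?f = "\<lambda>t. indicator {0<..} t * (exp (- (u * t)) * t powr (z - 1))"
  show "?f \<in> borel_measurable lborel" by measurable
  show "AE t in lborel. 0 \<le> ?f t" by simp
  show "0 \<le> Gamma z / u powr z" using z by (simp add: Gamma_real_pos less_imp_le)
  have "ennreal (Gamma z) = (\<integral>\<^sup>+ t. ennreal (indicator {0..} t * t powr (z - 1) / exp t) \<partial>lborel)"
    by (rule Gamma_conv_nn_integral_real[OF z])
  also have "\<dots> = \<bar>u\<bar> * (\<integral>\<^sup>+ t. ennreal (indicator {0..} (0 + u * t) * (0 + u * t) powr (z - 1) / exp (0 + u * t)) \<partial>lborel)"
    by (rule nn_integral_real_affine) (use u in auto)
  also have "(\<integral>\<^sup>+ t. ennreal (indicator {0..} (0 + u * t) * (0 + u * t) powr (z - 1) / exp (0 + u * t)) \<partial>lborel)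
     = (\<integral>\<^sup>+ t. ennreal (u powr (z - 1)) * ennreal (?f t) \<partial>lborel)"
    using u by (intro nn_integral_cong)
       (auto simp: indicator_def powr_mult exp_minus field_simps zero_le_mult_iff simp flip: ennreal_mult)
  also have "\<dots> = ennreal (u powr (z - 1)) * (\<integral>\<^sup>+ t. ennreal (?f t) \<partial>lborel)"
    by (rule nn_integral_cmult) measurable
  finally have "ennreal (Gamma z) = ennreal (u powr z) * (\<integral>\<^sup>+ t. ennreal (?f t) \<partial>lborel)"
    using u by (simp add: mult.assoc[symmetric] ennreal_mult[symmetric] powr_mult_base)
  then have "ennreal (1 / u powr z) * ennreal (Gamma z) = (ennreal (1 / u powr z) * ennreal (u powr z)) * (\<integral>\<^sup>+ t. ennreal (?f t) \<partial>lborel)"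
    by (simp add: mult.assoc)
  also have "ennreal (1 / u powr z) * ennreal (u powr z) = 1"
    using u by (simp flip: ennreal_mult)
  finally show "(\<integral>\<^sup>+ t. ennreal (?f t) \<partial>lborel) = ennreal (Gamma z / u powr z)"
    using u z by (simp add: Gamma_real_pos flip: ennreal_mult')
qed

text \<open>
  Convergence for every argument. The choice \<open>R powr a = 2 * K * (\<bar>y\<bar> + 1)\<close> in the Gamma bound
  makes the terms decay at least like \<open>(1 / 2) ^ k\<close>.
\<close>

lemma summable_mittag_leffler:
  fixes c :: "nat \<Rightarrow> real"
  assumes a: "0 < a" and K: "0 < K" and c: "\<And>k. \<bar>c k\<bar> \<le> K ^ k"
  shows "summable (\<lambda>k. c k / Gamma (a * real k + a) * y ^ k)"
proof -
  define R where "R = (2 * K * (\<bar>y\<bar> + 1)) powr (1 / a)"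
  have R: "R > 0" "R powr a = 2 * K * (\<bar>y\<bar> + 1)" using K a by (auto simp: R_def powr_powr)
  show ?thesis
  proof (rule summable_comparison_test_ev)
    have "eventually (\<lambda>k. a * real k + a \<ge> 1) sequentially" using a by real_asymp
    then show "eventually (\<lambda>k. norm (c k / Gamma (a * real k + a) * y ^ k)
        \<le> (R powr (1 - a) * exp R) * (1 / 2) ^ k) sequentially"
    proof eventually_elim
      case (elim k)
      have "R powr (a * real k + a - 1) = (R powr a) ^ k * R powr (a - 1)"
        using R(1) by (simp add: powr_add[symmetric] powr_powr algebra_simps flip: powr_realpow)
      then have lower: "(2 * K * (\<bar>y\<bar> + 1)) ^ k * R powr (a - 1) * exp (- R) \<le> Gamma (a * real k + a)" (is "?L \<le> _")
        using Gamma_ge_powr_exp[OF elim R(1)] R(2) by simp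
      have L: "?L > 0" using K R(1) by (intro mult_pos_pos zero_less_power) auto
      have "norm (c k / Gamma (a * real k + a) * y ^ k) = \<bar>c k\<bar> * \<bar>y\<bar> ^ k / \<bar>Gamma (a * real k + a)\<bar>"
        by (simp add: abs_mult power_abs)
      also have "\<dots> \<le> (K ^ k * (\<bar>y\<bar> + 1) ^ k) / ?L"
        using lower L c K by (intro frac_le mult_mono power_mono) auto
      also have "\<dots> = (R powr (1 - a) * exp R) * (1 / 2) ^ k"
      proof -
        define q where "q = K ^ k * (\<bar>y\<bar> + 1) ^ k"
        have "q > 0" using K by (auto simp: q_def intro!: mult_pos_pos zero_less_power)
        have "(2 * K * (\<bar>y\<bar> + 1)) ^ k = 2 ^ k * q" by (simp add: q_def power_mult_distrib mult.assoc)
        then show ?thesis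
          unfolding q_def[symmetric]
          using \<open>q > 0\<close> R(1) by (simp only:) (simp add: exp_minus field_simps powr_diff power_one_over)
      qed
      finally show ?case .
    qed
    show "summable (\<lambda>k. (R powr (1 - a) * exp R) * (1 / 2) ^ k)"
      by (intro summable_mult summable_geometric) simp
  qed
qed

text \<open>
  Each power \<open>t powr (a * k + a - 1)\<close> has Laplace transform \<open>Gamma (a * k + a) / u powr (a * k + a)\<close>,
  so the Gamma factors cancel and a geometric series remains. The condition \<open>K < u powr a\<close> makes it
  converge absolutely, which justifies the interchange.
\<close>

lemma laplace_mittag_leffler_series:
  fixes c :: "nat \<Rightarrow> real"
  assumes a: "0 < a" and K: "0 < K" and c: "\<And>k. \<bar>c k\<bar> \<le> K ^ k"
    and u: "u > 0" "K < u powr a"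
  shows "has_bochner_integral lborel
     (\<lambda>t. indicator {0<..} t * (exp (- (u * t)) * t powr (a - 1) * (\<Sum>k. c k / Gamma (a * real k + a) * (t powr a) ^ k)))
     (\<Sum>k. c k / (u powr a) ^ Suc k)"
proof -
  define f where "f k t = c k / Gamma (a * real k + a) * (indicator {0<..} t * (exp (- (u * t)) * t powr (a * real k + a - 1)))" for k t
  have pos: "a * real k + a > 0" for k using a by (simp add: add_nonneg_pos)
  have G: "Gamma (a * real k + a) > 0" for k using pos by (simp add: Gamma_real_pos)
  have up: "u powr (a * real k + a) = (u powr a) ^ Suc k" for k
    using u by (simp add: powr_powr powr_add algebra_simps flip: powr_realpow)
  have hb: "has_bochner_integral lborel (f k) (c k / (u powr a) ^ Suc k)" for k
    using has_bochner_integral_mult_right[OF laplace_powr[OF pos[of k] u(1)], of "c k / Gamma (a * real k + a)"] G[of k]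
    unfolding f_def[abs_def] up by simp
  have hbn: "has_bochner_integral lborel (\<lambda>t. norm (f k t)) (\<bar>c k\<bar> / (u powr a) ^ Suc k)" for k
    using has_bochner_integral_mult_right[OF laplace_powr[OF pos[of k] u(1)], of "\<bar>c k\<bar> / Gamma (a * real k + a)"] G[of k]
    unfolding f_def[abs_def] up by (simp add: abs_mult)
  have sumn: "summable (\<lambda>t. norm (f t x))" for x
  proof (cases "x > 0")
    case True
    have "norm (f k x) = exp (- (u * x)) * x powr (a - 1) * norm (c k / Gamma (a * real k + a) * (x powr a) ^ k)" for k
      using True by (simp add: f_def abs_mult powr_powr powr_add powr_diff algebra_simps flip: powr_realpow)
    moreover have "summable (\<lambda>k. norm (c k / Gamma (a * real k + a) * (x powr a) ^ k))"
    proof -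
      have "summable (\<lambda>k. \<bar>c k\<bar> / Gamma (a * real k + a) * (x powr a) ^ k)"
        by (rule summable_mittag_leffler[OF a K]) (use c in simp)
      then show ?thesis using G by (simp add: abs_mult less_imp_le)
    qed
    ultimately show ?thesis
      by (simp only: summable_mult)
  next
    case False then show ?thesis by (simp add: f_def)
  qed
  have sums: "summable (\<lambda>k. \<integral>t. norm (f k t) \<partial>lborel)"
  proof (rule summable_comparison_test)
    have "K / u powr a < 1" using K u by simp
    then show "summable (\<lambda>k. (1 / u powr a) * (K / u powr a) ^ k)"
      using K u by (intro summable_mult summable_geometric) simp
    show "\<exists>N. \<forall>k\<ge>N. norm (\<integral>t. norm (f k t) \<partial>lborel) \<le> (1 / u powr a) * (K / u powr a) ^ k"
      unfolding has_bochner_integral_integral_eq[OF hbn]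
      using c u by (auto simp: power_divide abs_mult intro!: divide_right_mono)
  qed
  have fi: "integrable lborel (f k)" for k using hb[of k] by (simp add: has_bochner_integral_iff)
  have eq: "(\<Sum>k. f k t) = indicator {0<..} t * (exp (- (u * t)) * t powr (a - 1) * (\<Sum>k. c k / Gamma (a * real k + a) * (t powr a) ^ k))" for t
  proof (cases "t > 0")
    case True
    have "f k t = exp (- (u * t)) * t powr (a - 1) * (c k / Gamma (a * real k + a) * (t powr a) ^ k)" for k
      using True by (simp add: f_def powr_powr powr_add powr_diff algebra_simps flip: powr_realpow)
    then have "(\<Sum>k. f k t) = exp (- (u * t)) * t powr (a - 1) * (\<Sum>k. c k / Gamma (a * real k + a) * (t powr a) ^ k)"
      by (simp only: suminf_mult[OF summable_mittag_leffler[OF a K c, of "t powr a"]])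
    then show ?thesis using True by simp
  next
    case False then show ?thesis by (simp add: f_def)
  qed
  have "integrable lborel (\<lambda>t. \<Sum>k. f k t)"
    by (rule integrable_suminf[OF fi AE_I2[OF sumn] sums])
  moreover have "(\<integral>t. (\<Sum>k. f k t) \<partial>lborel) = (\<Sum>k. c k / (u powr a) ^ Suc k)"
    by (subst integral_suminf[OF fi AE_I2[OF sumn] sums]) (simp add: has_bochner_integral_integral_eq[OF hb])
  ultimately show ?thesis
    by (simp add: has_bochner_integral_iff eq)
qed

lemma pow_mat_entry_bound:
  fixes C :: "real mat"
  assumes C: "C \<in> carrier_mat p p"
  obtains K where "K > 0" "\<And>k i j. i < p \<Longrightarrow> j < p \<Longrightarrow> \<bar>(C ^\<^sub>m k) $$ (i, j)\<bar> \<le> K ^ k"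
proof -
  define b where "b = 1 + (\<Sum>i<p. \<Sum>j<p. \<bar>C $$ (i, j)\<bar>)"
  have b: "\<bar>C $$ (i, j)\<bar> \<le> b" if "i < p" "j < p" for i j
  proof -
    have "\<bar>C $$ (i, j)\<bar> \<le> (\<Sum>j<p. \<bar>C $$ (i, j)\<bar>)"
      using that by (intro member_le_sum) auto
    also have "\<dots> \<le> (\<Sum>i<p. \<Sum>j<p. \<bar>C $$ (i, j)\<bar>)"
      using that by (intro member_le_sum[of i _ "\<lambda>i. \<Sum>j<p. \<bar>C $$ (i, j)\<bar>"]) (auto intro!: sum_nonneg)
    finally show ?thesis by (simp add: b_def)
  qed
  have b0: "b > 0" by (auto simp: b_def intro!: add_pos_nonneg sum_nonneg)
  have "\<bar>(C ^\<^sub>m k) $$ (i, j)\<bar> \<le> (real (Suc p) * b) ^ k" if "i < p" "j < p" for k i j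
    using that
  proof (induction k arbitrary: j)
    case 0 then show ?case using C by simp
  next
    case (Suc k)
    have Ck: "C ^\<^sub>m k \<in> carrier_mat p p" using C by simp
    have "(C ^\<^sub>m Suc k) $$ (i, j) = (\<Sum>l<p. (C ^\<^sub>m k) $$ (i, l) * C $$ (l, j))"
      using Suc.prems C Ck by (simp add: scalar_prod_def atLeast0LessThan)
    also have "\<bar>\<dots>\<bar> \<le> (\<Sum>l<p. \<bar>(C ^\<^sub>m k) $$ (i, l) * C $$ (l, j)\<bar>)" by (rule sum_abs)
    also have "\<dots> \<le> (\<Sum>l<p. (real (Suc p) * b) ^ k * b)"
      unfolding abs_mult using Suc.prems Suc.IH b b0 by (intro sum_mono mult_mono) auto
    also have "\<dots> = (real (Suc p) * b) ^ k * (real p * b)" by simp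
    also have "\<dots> \<le> (real (Suc p) * b) ^ k * (real (Suc p) * b)"
      using b0 by (intro mult_left_mono mult_right_mono) auto
    finally show ?case by (simp add: mult.commute)
  qed
  then show ?thesis using b0 by (intro that[of "real (Suc p) * b"]) auto
qed

text \<open>
  Multiplying the series by \<open>s I - C\<close> produces a telescoping sum.
\<close>

lemma neumann_series_resolvent:
  fixes C :: "real mat"
  assumes C: "C \<in> carrier_mat p p" and K: "K > 0" "K < s"
    and b: "\<And>k i j. i < p \<Longrightarrow> j < p \<Longrightarrow> \<bar>(C ^\<^sub>m k) $$ (i, j)\<bar> \<le> K ^ k"
  shows "mat_inv (s \<cdot>\<^sub>m 1\<^sub>m p - C) = mat p p (\<lambda>(i, j). \<Sum>k. (C ^\<^sub>m k) $$ (i, j) / s ^ Suc k)"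
    (is "_ = ?S")
proof -
  have s: "s > 0" using K by simp
  have sm: "summable (\<lambda>k. (C ^\<^sub>m k) $$ (i, j) / s ^ Suc k)" if "i < p" "j < p" for i j
  proof (rule summable_comparison_test)
    show "summable (\<lambda>k. (1 / s) * (K / s) ^ k)"
      using K s by (intro summable_mult summable_geometric) simp
    show "\<exists>N. \<forall>k\<ge>N. norm ((C ^\<^sub>m k) $$ (i, j) / s ^ Suc k) \<le> (1 / s) * (K / s) ^ k"
      using b[OF that] s by (auto simp: power_divide abs_mult intro!: divide_right_mono)
  qed
  have "?S * (s \<cdot>\<^sub>m 1\<^sub>m p - C) = 1\<^sub>m p"
  proof (rule eq_matI)
    fix i j assume ij: "i < dim_row (1\<^sub>m p :: real mat)" "j < dim_col (1\<^sub>m p :: real mat)"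
    have Ck: "C ^\<^sub>m k \<in> carrier_mat p p" for k using C by simp
    have step: "(\<Sum>l<p. (C ^\<^sub>m k) $$ (i, l) / s ^ Suc k * C $$ (l, j)) = (C ^\<^sub>m Suc k) $$ (i, j) / s ^ Suc k" for k
      using ij C Ck[of k] by (simp add: scalar_prod_def atLeast0LessThan sum_divide_distrib)
    have "(?S * (s \<cdot>\<^sub>m 1\<^sub>m p - C)) $$ (i, j) = (\<Sum>l<p. ?S $$ (i, l) * (s \<cdot>\<^sub>m 1\<^sub>m p - C) $$ (l, j))"
      using ij C by (simp add: scalar_prod_def atLeast0LessThan)
    also have "\<dots> = (\<Sum>l<p. ?S $$ (i, l) * (if l = j then s else 0) - ?S $$ (i, l) * C $$ (l, j))"
      using ij C by (intro sum.cong) (auto simp: algebra_simps)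
    also have "\<dots> = (\<Sum>l<p. ?S $$ (i, l) * (if l = j then s else 0)) - (\<Sum>l<p. ?S $$ (i, l) * C $$ (l, j))"
      by (rule sum_subtractf)
    also have "(\<Sum>l<p. ?S $$ (i, l) * (if l = j then s else 0)) = ?S $$ (i, j) * s"
      using ij by (simp add: if_distrib[of "(*) _"] cong: if_cong)
    also have "?S $$ (i, j) * s = (\<Sum>k. (C ^\<^sub>m k) $$ (i, j) / s ^ k)"
      using ij s sm[of i j] by (simp add: suminf_mult2)
    also have "(\<Sum>l<p. ?S $$ (i, l) * C $$ (l, j)) = (\<Sum>l<p. \<Sum>k. (C ^\<^sub>m k) $$ (i, l) / s ^ Suc k * C $$ (l, j))"
      using ij sm by (intro sum.cong refl) (simp add: suminf_mult2)
    also have "\<dots> = (\<Sum>k. \<Sum>l<p. (C ^\<^sub>m k) $$ (i, l) / s ^ Suc k * C $$ (l, j))"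
      using ij sm by (intro suminf_sum[symmetric] summable_mult2) auto
    also have "\<dots> = (\<Sum>k. (C ^\<^sub>m Suc k) $$ (i, j) / s ^ Suc k)" by (simp only: step)
    also have "(\<Sum>k. (C ^\<^sub>m k) $$ (i, j) / s ^ k) - \<dots> = (C ^\<^sub>m 0) $$ (i, j) / s ^ 0"
    proof -
      have "summable (\<lambda>k. s * ((C ^\<^sub>m k) $$ (i, j) / s ^ Suc k))"
        using ij sm by (intro summable_mult) auto
      then have "summable (\<lambda>k. (C ^\<^sub>m k) $$ (i, j) / s ^ k)" using s by simp
      from suminf_split_head[OF this] show ?thesis by simp
    qed
    also have "\<dots> = 1\<^sub>m p $$ (i, j)" using C by simp
    finally show "(?S * (s \<cdot>\<^sub>m 1\<^sub>m p - C)) $$ (i, j) = 1\<^sub>m p $$ (i, j)" .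
  qed (use C in auto)
  then show ?thesis
    using C by (intro mat_inv_eqI mat_mult_left_right_inverse[of ?S]) auto
qed

lemma mittag_leffler_entry_powser:
  fixes C :: "real mat"
  assumes C: "C \<in> carrier_mat p p" and ij: "i < p" "j < p"
  shows "mittag_leffler a a (s \<cdot>\<^sub>m C) $$ (i, j) = (\<Sum>k. (C ^\<^sub>m k) $$ (i, j) / Gamma (a * real k + a) * s ^ k)"
proof -
  have pw: "(s \<cdot>\<^sub>m C) ^\<^sub>m k = s ^ k \<cdot>\<^sub>m C ^\<^sub>m k" for k
  proof (induction k)
    case 0 show ?case using C by (intro eq_matI) auto
  next
    case (Suc k)
    have Ck: "C ^\<^sub>m k \<in> carrier_mat p p" using C by simp
    show ?case
      using C Ck Suc.IH by (intro eq_matI) (auto simp: mult_ac)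
  qed
  have "(s ^ k \<cdot>\<^sub>m C ^\<^sub>m k) $$ (i, j) = s ^ k * (C ^\<^sub>m k) $$ (i, j)" for k
    using C ij by (subst index_smult_mat) auto
  then show ?thesis using C ij by (simp add: mittag_leffler_def pw mult_ac)
qed

lemma isCont_mittag_leffler_entry:
  fixes C :: "real mat"
  assumes a: "0 < a" and C: "C \<in> carrier_mat p p" and ij: "i < p" "j < p"
  shows "isCont (\<lambda>s. mittag_leffler a a (s \<cdot>\<^sub>m C) $$ (i, j)) s"
proof -
  obtain K where K: "K > 0" "\<And>k i j. i < p \<Longrightarrow> j < p \<Longrightarrow> \<bar>(C ^\<^sub>m k) $$ (i, j)\<bar> \<le> K ^ k"
    using pow_mat_entry_bound[OF C] by metis
  show ?thesis
    unfolding mittag_leffler_entry_powser[OF C ij]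
    by (intro isCont_powser_converges_everywhere summable_mittag_leffler[OF a K(1)] K(2) ij)
qed

lemma laplace_mittag_leffler_entry:
  fixes C :: "real mat"
  assumes a: "0 < a" and C: "C \<in> carrier_mat p p"
  shows "\<exists>u0>0. \<forall>u\<ge>u0. \<forall>i<p. \<forall>j<p. has_bochner_integral lborel
     (\<lambda>t. indicator {0<..} t * (exp (- (u * t)) * t powr (a - 1) * mittag_leffler a a ((t powr a) \<cdot>\<^sub>m C) $$ (i, j)))
     (mat_inv (resolvent_mat u a C) $$ (i, j))"
proof -
  obtain K where K: "K > 0" "\<And>k i j. i < p \<Longrightarrow> j < p \<Longrightarrow> \<bar>(C ^\<^sub>m k) $$ (i, j)\<bar> \<le> K ^ k"
    using pow_mat_entry_bound[OF C] by metis
  \<comment> \<open>chosen so that \<open>u powr a \<ge> 2 * K > K\<close> for \<open>u \<ge> u0\<close>\<close>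
  let ?u0 = "(2 * K) powr (1 / a)"
  show ?thesis
  proof (intro exI[of _ ?u0] conjI allI impI)
    show "?u0 > 0" using K by simp
    fix u i j assume u: "u \<ge> ?u0" and ij: "i < p" "j < p"
    then have u0: "u > 0" using K(1) by (smt (verit) powr_gt_zero)
    have "?u0 powr a \<le> u powr a" using u a by (intro powr_mono2) auto
    moreover have "?u0 powr a = 2 * K" using K a by (simp add: powr_powr)
    ultimately have uK: "K < u powr a" using K(1) by linarith
    show "has_bochner_integral lborel
     (\<lambda>t. indicator {0<..} t * (exp (- (u * t)) * t powr (a - 1) * mittag_leffler a a ((t powr a) \<cdot>\<^sub>m C) $$ (i, j)))
     (mat_inv (resolvent_mat u a C) $$ (i, j))"
      using laplace_mittag_leffler_series[OF a K(1) K(2)[OF ij] u0 uK]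
        neumann_series_resolvent[OF C K(1) uK K(2)] C ij
      by (simp add: mittag_leffler_entry_powser[OF C ij] resolvent_mat_def)
  qed
qed

section \<open>Resolvents of sub-intensity matrices\<close>

lemma mult_mat_vec_index:
  assumes "A \<in> carrier_mat r c" "v \<in> carrier_vec c" "i < r"
  shows "(A *\<^sub>v v) $ i = (\<Sum>j<c. A $$ (i, j) * v $ j)"
  using assms by (simp add: scalar_prod_def atLeast0LessThan)

lemma mat_inv_of_injective:
  fixes A :: "real mat"
  assumes A: "A \<in> carrier_mat k k"
    and inj: "\<And>v. v \<in> carrier_vec k \<Longrightarrow> A *\<^sub>v v = 0\<^sub>v k \<Longrightarrow> v = 0\<^sub>v k"
  shows "mat_inv A \<in> carrier_mat k k" "A * mat_inv A = 1\<^sub>m k" "mat_inv A * A = 1\<^sub>m k"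
proof -
  have "det A \<noteq> 0" using inj det_0_iff_vec_prod_zero_field[OF A] by auto
  from det_non_zero_imp_unit[OF A this, of "()"]
  obtain B where B: "B \<in> carrier_mat k k" "A * B = 1\<^sub>m k" "B * A = 1\<^sub>m k"
    by (auto simp: Units_def ring_mat_def)
  with mat_inv_eqI[OF A B(1,2)]
  show "mat_inv A \<in> carrier_mat k k" "A * mat_inv A = 1\<^sub>m k" "mat_inv A * A = 1\<^sub>m k"
    by simp_all
qed

text \<open>
  Look at the row of the smallest entry of \<open>x\<close>. If that entry were negative, nonnegative off-diagonal
  entries and nonpositive row sums would force this row of \<open>(s I - C) x\<close> to be at most \<open>s\<close> times it.
\<close>

lemma sub_intensity_minimum_principle:
  assumes C: "sub_intensity p C" and s: "s > 0" and x: "x \<in> carrier_vec p"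
    and nonneg: "\<And>i. i < p \<Longrightarrow> 0 \<le> ((s \<cdot>\<^sub>m 1\<^sub>m p - C) *\<^sub>v x) $ i"
    and k: "k < p"
  shows "0 \<le> x $ k"
proof (rule ccontr)
  assume neg: "\<not> 0 \<le> x $ k"
  have Cc: "C \<in> carrier_mat p p" using C by (simp add: sub_intensity_def)
  have "finite ((\<lambda>i. x $ i) ` {..<p})" "(\<lambda>i. x $ i) ` {..<p} \<noteq> {}" using k by auto
  from Min_in[OF this] obtain i where i: "i < p" "x $ i = Min ((\<lambda>i. x $ i) ` {..<p})" by auto
  have min: "x $ i \<le> x $ j" if "j < p" for j using that by (simp add: i(2))
  have xi: "x $ i < 0" using min[OF k] neg by simp
  have "((s \<cdot>\<^sub>m 1\<^sub>m p - C) *\<^sub>v x) $ i = (\<Sum>j<p. (s \<cdot>\<^sub>m 1\<^sub>m p - C) $$ (i, j) * x $ j)"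
    using Cc x i(1) by (intro mult_mat_vec_index) auto
  also have "\<dots> = (\<Sum>j<p. (if i = j then s * x $ j else 0) - C $$ (i, j) * x $ j)"
    using Cc i(1) by (intro sum.cong) (auto simp: algebra_simps)
  also have "\<dots> = s * x $ i - (\<Sum>j<p. C $$ (i, j) * x $ j)"
    using i(1) by (simp add: sum_subtractf)
  also have "(\<Sum>j<p. C $$ (i, j) * x $ j) \<ge> (\<Sum>j<p. C $$ (i, j) * x $ i)"
  proof (rule sum_mono)
    fix j assume "j \<in> {..<p}"
    then show "C $$ (i, j) * x $ i \<le> C $$ (i, j) * x $ j"
      using C i(1) min[of j] by (cases "i = j") (auto simp: sub_intensity_def intro!: mult_left_mono)
  qed
  moreover have "(\<Sum>j<p. C $$ (i, j) * x $ i) \<ge> 0"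
    unfolding sum_distrib_right[symmetric] using C i(1) xi
    by (intro mult_nonpos_nonpos) (auto simp: sub_intensity_def)
  moreover have "s * x $ i < 0" using s xi by (simp add: mult_pos_neg)
  ultimately show False using nonneg[OF i(1)] by linarith
qed

lemma sub_intensity_shift_injective:
  assumes C: "sub_intensity p C" and s: "s \<ge> 0" and x: "x \<in> carrier_vec p"
    and zero: "(s \<cdot>\<^sub>m 1\<^sub>m p - C) *\<^sub>v x = 0\<^sub>v p"
  shows "x = 0\<^sub>v p"
proof (cases "s = 0")
  case False
  then have s: "s > 0" using s by simp
  have Cc: "C \<in> carrier_mat p p" using C by (simp add: sub_intensity_def)
  then have A: "s \<cdot>\<^sub>m 1\<^sub>m p - C \<in> carrier_mat p p" by (rule minus_carrier_mat)
  have neg: "(s \<cdot>\<^sub>m 1\<^sub>m p - C) *\<^sub>v (- x) = 0\<^sub>v p"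
  proof (rule eq_vecI)
    fix i assume "i < dim_vec (0\<^sub>v p :: real vec)"
    then have i: "i < p" by simp
    have "((s \<cdot>\<^sub>m 1\<^sub>m p - C) *\<^sub>v (- x)) $ i = - ((s \<cdot>\<^sub>m 1\<^sub>m p - C) *\<^sub>v x) $ i"
      using x i by (simp add: mult_mat_vec_index[OF A] sum_negf del: index_mult_mat_vec)
    then show "((s \<cdot>\<^sub>m 1\<^sub>m p - C) *\<^sub>v (- x)) $ i = 0\<^sub>v p $ i" using i by (simp add: zero)
  qed (use Cc in simp)
  show ?thesis
  proof (rule eq_vecI)
    fix k assume "k < dim_vec (0\<^sub>v p)"
    then show "x $ k = 0\<^sub>v p $ k"
      using sub_intensity_minimum_principle[OF C s x, of k] zero
        sub_intensity_minimum_principle[OF C s, of "- x" k] neg x by auto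
  qed (use x in simp)
next
  case True
  have Cc: "C \<in> carrier_mat p p" and "invertible_mat C" using C by (auto simp: sub_intensity_def)
  then obtain B where B: "C * B = 1\<^sub>m p" "B * C = 1\<^sub>m (dim_row B)"
    by (auto simp: invertible_mat_def inverts_mat_def)
  have Bc: "B \<in> carrier_mat p p"
  proof
    show "dim_col B = p" using arg_cong[OF B(1), of dim_col] by simp
    show "dim_row B = p" using arg_cong[OF B(2), of dim_col] Cc by simp
  qed
  have "(s \<cdot>\<^sub>m 1\<^sub>m p - C) = - C" using True Cc by (intro eq_matI) auto
  then have "- (C *\<^sub>v x) = 0\<^sub>v p" using zero Cc x by simp
  then have "C *\<^sub>v x = 0\<^sub>v p" using uminus_zero_vec_eq[of "C *\<^sub>v x" p] Cc by (metis mult_mat_vec_carrier uminus_uminus_vec uminus_zero_vec x)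
  then have "B *\<^sub>v (C *\<^sub>v x) = 0\<^sub>v p" using Bc by auto
  then show ?thesis using assoc_mult_mat_vec[OF Bc Cc x] B(2) Bc x by simp
qed

lemma mat_inv_resolvent:
  assumes C: "sub_intensity p C"
  shows "resolvent_mat u a C \<in> carrier_mat p p"
    and "x \<in> carrier_vec p \<Longrightarrow> resolvent_mat u a C *\<^sub>v x = 0\<^sub>v p \<Longrightarrow> x = 0\<^sub>v p"
    and "mat_inv (resolvent_mat u a C) \<in> carrier_mat p p"
    and "resolvent_mat u a C * mat_inv (resolvent_mat u a C) = 1\<^sub>m p"
    and "mat_inv (resolvent_mat u a C) * resolvent_mat u a C = 1\<^sub>m p"
proof -
  have Cc: "C \<in> carrier_mat p p" using C by (simp add: sub_intensity_def)
  then show R: "resolvent_mat u a C \<in> carrier_mat p p" by (auto simp: resolvent_mat_def)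
  show inj: "x \<in> carrier_vec p \<Longrightarrow> resolvent_mat u a C *\<^sub>v x = 0\<^sub>v p \<Longrightarrow> x = 0\<^sub>v p" for x
    using sub_intensity_shift_injective[OF C, of "u powr a"] Cc by (simp add: resolvent_mat_def)
  show "mat_inv (resolvent_mat u a C) \<in> carrier_mat p p"
    "resolvent_mat u a C * mat_inv (resolvent_mat u a C) = 1\<^sub>m p"
    "mat_inv (resolvent_mat u a C) * resolvent_mat u a C = 1\<^sub>m p"
    using mat_inv_of_injective[OF R inj] by blast+
qed

lemma resolvent_mat_zero:
  "C \<in> carrier_mat p p \<Longrightarrow> resolvent_mat 0 a C = - C"
  by (intro eq_matI) (auto simp: resolvent_mat_def)

text \<open>
  The minimum principle needs a strictly positive shift, so the inverse of \<open>- C\<close> is approached by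
  that of \<open>s I - C\<close>, \<open>s \<rightarrow> 0\<close>. Write \<open>N\<close> for the former and \<open>w \<ge> 0\<close> for a column of the
  latter; the resolvent identity says that \<open>w + s N w\<close> is the column of \<open>N\<close>, and \<open>w\<close> stays
  bounded.
\<close>

lemma uminus_sub_intensity_inverse_nonneg:
  assumes C: "sub_intensity p C" and ij: "i < p" "j < p"
  shows "0 \<le> mat_inv (- C) $$ (i, j)"
proof -
  have Cc: "C \<in> carrier_mat p p" using C by (simp add: sub_intensity_def)
  define N where "N = mat_inv (- C)"
  have N: "N \<in> carrier_mat p p" "- C * N = 1\<^sub>m p" "N * (- C) = 1\<^sub>m p"
    using mat_inv_resolvent(3-5)[OF C, of 0 1] Cc by (auto simp: N_def resolvent_mat_zero)
  define b where "b = (\<Sum>k<p. \<Sum>l<p. \<bar>N $$ (k, l)\<bar>)"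
  have b0: "b \<ge> 0" by (auto simp: b_def intro!: sum_nonneg)
  define X where "X = (\<Sum>k<p. \<bar>N $$ (k, j)\<bar>)"
  have X0: "X \<ge> 0" by (auto simp: X_def intro!: sum_nonneg)
  \<comment> \<open>\<open>s\<close> is so small that the perturbation \<open>s N w\<close> has at most half the size of \<open>w\<close>\<close>
  have lower: "- (2 * b * X) * s \<le> N $$ (i, j)" if s: "s > 0" "2 * s * b \<le> 1" for s
  proof -
    define A where "A = s \<cdot>\<^sub>m 1\<^sub>m p - C"
    have A: "A \<in> carrier_mat p p" unfolding A_def by (rule minus_carrier_mat[OF Cc])
    have inj: "v = 0\<^sub>v p" if "v \<in> carrier_vec p" "A *\<^sub>v v = 0\<^sub>v p" for v
      using sub_intensity_shift_injective[OF C _ that(1), of s] that(2) s by (simp add: A_def)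
    have Ai: "mat_inv A \<in> carrier_mat p p" "A * mat_inv A = 1\<^sub>m p"
      using mat_inv_of_injective[OF A inj] by auto
    define w where "w = col (mat_inv A) j"
    have w: "w \<in> carrier_vec p" using Ai ij by (simp add: w_def)
    have Aw: "A *\<^sub>v w = unit_vec p j"
      using Ai A ij by (simp add: w_def col_mult2[symmetric] del: col_mult2)
    have w0: "0 \<le> w $ k" if "k < p" for k
      using sub_intensity_minimum_principle[OF C s(1) w _ that] Aw ij by (simp add: A_def unit_vec_def)
    have res: "N $$ (k, j) = w $ k + s * (N *\<^sub>v w) $ k" if "k < p" for k
    proof -
      have "N *\<^sub>v (A *\<^sub>v w) = N *\<^sub>v unit_vec p j" by (simp add: Aw)
      moreover have "N *\<^sub>v (A *\<^sub>v w) = s \<cdot>\<^sub>v (N *\<^sub>v w) + w"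
      proof -
        have "N *\<^sub>v (A *\<^sub>v w) = (N * A) *\<^sub>v w" using N(1) A w by simp
        also have "N * A = s \<cdot>\<^sub>m N + 1\<^sub>m p"
        proof -
          have "A = s \<cdot>\<^sub>m 1\<^sub>m p + - C" unfolding A_def using Cc by (intro eq_matI) auto
          then have "N * A = N * (s \<cdot>\<^sub>m 1\<^sub>m p) + N * (- C)"
            using mult_add_distrib_mat[OF N(1), of "s \<cdot>\<^sub>m 1\<^sub>m p" p "- C"] Cc by simp
          also have "N * (s \<cdot>\<^sub>m 1\<^sub>m p) = s \<cdot>\<^sub>m N"
            using N(1) by (subst mult_smult_distrib[of N p p]) auto
          finally show ?thesis using N(3) by simp
        qed
        also have "\<dots> *\<^sub>v w = s \<cdot>\<^sub>v (N *\<^sub>v w) + w"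
          using N(1) w by (subst add_mult_distrib_mat_vec[of _ p p]) auto
        finally show ?thesis .
      qed
      moreover have "N *\<^sub>v unit_vec p j = col N j" 
        using N(1) ij by (intro eq_vecI)
          (auto simp: mult_mat_vec_index[OF N(1)] unit_vec_def if_distrib[of "(*) _"] simp del: index_mult_mat_vec cong: if_cong)
      ultimately have "col N j = s \<cdot>\<^sub>v (N *\<^sub>v w) + w" by simp
      from arg_cong[OF this, of "\<lambda>v. v $ k"] show ?thesis using that N(1) w ij by simp
    qed
    define W where "W = (\<Sum>k<p. \<bar>w $ k\<bar>)"
    have Nw: "(\<Sum>k<p. \<bar>(N *\<^sub>v w) $ k\<bar>) \<le> b * W"
    proof -
      have "(\<Sum>k<p. \<bar>(N *\<^sub>v w) $ k\<bar>) \<le> (\<Sum>k<p. \<Sum>l<p. \<bar>N $$ (k, l)\<bar> * \<bar>w $ l\<bar>)"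
        using w by (intro sum_mono) (simp add: mult_mat_vec_index[OF N(1)] del: index_mult_mat_vec flip: abs_mult)
      also have "\<dots> \<le> (\<Sum>k<p. \<Sum>l<p. \<bar>N $$ (k, l)\<bar> * W)"
        unfolding W_def by (intro sum_mono mult_left_mono member_le_sum) auto
      also have "\<dots> = b * W" by (simp add: b_def sum_distrib_right)
      finally show ?thesis .
    qed
    have "W \<le> (\<Sum>k<p. \<bar>N $$ (k, j)\<bar> + s * \<bar>(N *\<^sub>v w) $ k\<bar>)"
      unfolding W_def
    proof (rule sum_mono)
      fix k assume "k \<in> {..<p}"
      then have "w $ k = N $$ (k, j) - s * (N *\<^sub>v w) $ k" using res by simp
      then show "\<bar>w $ k\<bar> \<le> \<bar>N $$ (k, j)\<bar> + s * \<bar>(N *\<^sub>v w) $ k\<bar>"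
        using s abs_triangle_ineq4[of "N $$ (k, j)" "s * (N *\<^sub>v w) $ k"] by (simp add: abs_mult)
    qed
    also have "\<dots> = X + s * (\<Sum>k<p. \<bar>(N *\<^sub>v w) $ k\<bar>)"
      by (simp add: X_def sum.distrib sum_distrib_left)
    also have "\<dots> \<le> X + s * (b * W)" using Nw s by (intro add_left_mono mult_left_mono) auto
    also have "s * (b * W) = (s * b) * W" by simp
    also have "(s * b) * W \<le> 1 / 2 * W"
      using s by (intro mult_right_mono) (auto simp: W_def intro!: sum_nonneg)
    finally have W: "W \<le> 2 * X" by simp
    have "\<bar>(N *\<^sub>v w) $ i\<bar> \<le> (\<Sum>k<p. \<bar>(N *\<^sub>v w) $ k\<bar>)"
      using ij by (intro member_le_sum) auto
    also have "\<dots> \<le> b * W" by (rule Nw)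
    also have "\<dots> \<le> b * (2 * X)" using W b0 by (intro mult_left_mono)
    finally have "- (b * (2 * X)) \<le> (N *\<^sub>v w) $ i" by linarith
    then have "s * - (b * (2 * X)) \<le> s * (N *\<^sub>v w) $ i" using s by (intro mult_left_mono) auto
    then show ?thesis using res[OF ij(1)] w0[OF ij(1)] by (simp add: mult_ac)
  qed
  have "N $$ (i, j) \<ge> 0"
  proof (rule tendsto_le)
    show "((\<lambda>s. N $$ (i, j)) \<longlongrightarrow> N $$ (i, j)) (at_right (0::real))" by simp
    have "((\<lambda>s. - (2 * b * X) * s) \<longlongrightarrow> - (2 * b * X) * 0) (at_right 0)"
      by (intro tendsto_intros)
    then show "((\<lambda>s. - (2 * b * X) * s) \<longlongrightarrow> 0) (at_right 0)" by simp
    have "eventually (\<lambda>s. s \<in> {0<..<1 / (2 * b + 1)}) (at_right 0)"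
      using b0 by (intro eventually_at_right_real) auto
    then show "eventually (\<lambda>s. - (2 * b * X) * s \<le> N $$ (i, j)) (at_right 0)"
    proof eventually_elim
      case (elim s)
      then have "s * (2 * b + 1) \<le> 1" using b0 by (simp add: field_simps)
      then show ?case using elim by (intro lower) (auto simp: algebra_simps)
    qed
  qed simp
  then show ?thesis by (simp add: N_def)
qed

section \<open>Row vectors and ordered matrix products\<close>

lemma row_mult_scalar_prod:
  assumes "P \<in> carrier_mat k m" "w \<in> carrier_vec m" "v \<in> carrier_vec k"
  shows "v \<bullet> (P *\<^sub>v w) = row_mult v P \<bullet> w"
proof -
  have "v \<bullet> (P *\<^sub>v w) = (\<Sum>i<k. \<Sum>j<m. v $ i * (P $$ (i, j) * w $ j))"
    using assms by (simp add: scalar_prod_def atLeast0LessThan sum_distrib_left)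
  also have "\<dots> = (\<Sum>j<m. \<Sum>i<k. v $ i * (P $$ (i, j) * w $ j))"
    by (rule sum.swap)
  also have "\<dots> = row_mult v P \<bullet> w"
    using assms by (simp add: row_mult_def scalar_prod_def atLeast0LessThan sum_distrib_right mult.assoc)
  finally show ?thesis .
qed

lemma row_mult_mult:
  assumes "P \<in> carrier_mat k m" "Q \<in> carrier_mat m r" "v \<in> carrier_vec k" "j < r"
  shows "row_mult v (P * Q) $ j = (\<Sum>l<m. row_mult v P $ l * Q $$ (l, j))"
proof -
  have "row_mult v (P * Q) $ j = v \<bullet> (P *\<^sub>v col Q j)"
    using assms col_mult2[OF assms(1,2,4)] by (simp add: row_mult_def del: col_mult2)
  also have "\<dots> = row_mult v P \<bullet> col Q j"
    using assms by (intro row_mult_scalar_prod) auto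
  also have "\<dots> = (\<Sum>l<m. row_mult v P $ l * Q $$ (l, j))"
    using assms by (simp add: scalar_prod_def atLeast0LessThan)
  finally show ?thesis .
qed

lemma mat_prod_carrier:
  assumes "\<And>i. i \<in> {1..n} \<Longrightarrow> A i \<in> carrier_mat (q i) (q (i + 1))" and "m \<le> n"
  shows "mat_prod (q 1) A m \<in> carrier_mat (q 1) (q (m + 1))"
  using \<open>m \<le> n\<close> by (induction m) (use assms(1) in \<open>auto intro!: mult_carrier_mat\<close>)

lemma mat_prod_cong:
  "(\<And>i. i \<in> {1..m} \<Longrightarrow> A i = B i) \<Longrightarrow> mat_prod d A m = mat_prod d B m"
  by (induction m) auto

lemma mult_mat_vec_carrier_dim: "A \<in> carrier_mat r c \<Longrightarrow> A *\<^sub>v v \<in> carrier_vec r"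
  by (intro carrier_vecI) simp

text \<open>
  The factors after the \<open>m\<close>-th are absorbed into a vector one by one; \<open>w i\<close> is what remains of the
  vector after the factors \<open>i, \<dots>, n\<close>.
\<close>

lemma mat_prod_mult_tail:
  assumes A: "\<And>i. i \<in> {1..n} \<Longrightarrow> A i \<in> carrier_mat (q i) (q (i + 1))"
    and w: "\<And>i. i \<in> {m + 1..n} \<Longrightarrow> A i *\<^sub>v w (i + 1) = w i"
    and wc: "w (n + 1) \<in> carrier_vec (q (n + 1))"
    and "m \<le> n"
  shows "mat_prod (q 1) A n *\<^sub>v w (n + 1) = mat_prod (q 1) A m *\<^sub>v w (m + 1)"
proof -
  have wc': "w i \<in> carrier_vec (q i)" if "i \<in> {m + 1..n + 1}" for i
  proof (cases "i = n + 1")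
    case False
    then have i: "i \<in> {m + 1..n}" using that by auto
    then have "A i \<in> carrier_mat (q i) (q (i + 1))" using A[of i] by simp
    then have "A i *\<^sub>v w (i + 1) \<in> carrier_vec (q i)" by (rule mult_mat_vec_carrier_dim)
    then show ?thesis using w[OF i] by simp
  qed (use wc in simp)
  have "mat_prod (q 1) A k *\<^sub>v w (k + 1) = mat_prod (q 1) A m *\<^sub>v w (m + 1)" if "m \<le> k" "k \<le> n" for k
    using that
  proof (induction k rule: dec_induct)
    case (step k)
    have k: "m \<le> k" "Suc k \<le> n" using step.hyps step.prems by auto
    have "mat_prod (q 1) A (Suc k) *\<^sub>v w (Suc k + 1) = mat_prod (q 1) A k *\<^sub>v (A (Suc k) *\<^sub>v w (Suc k + 1))"
      unfolding mat_prod.simps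
    proof (rule assoc_mult_mat_vec)
      show "mat_prod (q 1) A k \<in> carrier_mat (q 1) (q (k + 1))"
        using A k by (intro mat_prod_carrier[where n=n]) auto
      show "A (Suc k) \<in> carrier_mat (q (k + 1)) (q (Suc k + 1))"
        using A[of "Suc k"] k by simp
      show "w (Suc k + 1) \<in> carrier_vec (q (Suc k + 1))"
        using k by (intro wc') simp
    qed
    also have "A (Suc k) *\<^sub>v w (Suc k + 1) = w (k + 1)"
      using w[of "Suc k"] k by simp
    also have "mat_prod (q 1) A k *\<^sub>v w (k + 1) = mat_prod (q 1) A m *\<^sub>v w (m + 1)"
      using k by (intro step.IH) auto
    finally show ?case .
  qed simp
  from this[OF \<open>m \<le> n\<close> order_refl] show ?thesis .
qed

lemma mat_prod_smult:
  assumes A: "\<And>i. i \<in> {1..n} \<Longrightarrow> A i \<in> carrier_mat (q i) (q (i + 1))" and "m \<le> n"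
  shows "mat_prod (q 1) (\<lambda>i. c i \<cdot>\<^sub>m A i) m = (\<Prod>i=1..m. c i) \<cdot>\<^sub>m mat_prod (q 1) A m"
  using \<open>m \<le> n\<close>
proof (induction m)
  case 0 show ?case by (auto intro!: eq_matI)
next
  case (Suc m)
  have P: "mat_prod (q 1) A m \<in> carrier_mat (q 1) (q (m + 1))"
    using A Suc.prems by (intro mat_prod_carrier[where n=n]) auto
  have Q: "A (Suc m) \<in> carrier_mat (q (m + 1)) (q (Suc m + 1))"
    using A[of "Suc m"] Suc.prems by simp
  have "mat_prod (q 1) (\<lambda>i. c i \<cdot>\<^sub>m A i) (Suc m)
      = ((\<Prod>i=1..m. c i) \<cdot>\<^sub>m mat_prod (q 1) A m) * (c (Suc m) \<cdot>\<^sub>m A (Suc m))"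
    using Suc by simp
  also have "\<dots> = (\<Prod>i=1..m. c i) \<cdot>\<^sub>m (c (Suc m) \<cdot>\<^sub>m (mat_prod (q 1) A m * A (Suc m)))"
    by (simp only: mult_smult_assoc_mat[OF P smult_carrier_mat[OF Q]] mult_smult_distrib[OF P Q])
  finally show ?case by (auto intro!: eq_matI simp: mult_ac)
qed

lemma ones_carrier [simp]: "ones k \<in> carrier_vec k" "dim_vec (ones k) = k"
  by (simp_all add: ones_def)

lemma scalar_prod_ones: "v \<in> carrier_vec k \<Longrightarrow> v \<bullet> ones k = (\<Sum>j<k. v $ j)"
  by (simp add: scalar_prod_def ones_def atLeast0LessThan)

lemma row_mult_carrier: "P \<in> carrier_mat k m \<Longrightarrow> row_mult v P \<in> carrier_vec m"
  by (auto simp: row_mult_def intro!: carrier_vecI)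

lemma row_mult_one: "v \<in> carrier_vec k \<Longrightarrow> row_mult v (1\<^sub>m k) = v"
  by (intro eq_vecI) (auto simp: row_mult_def)

lemma backward_recursion_exists:
  fixes A :: "nat \<Rightarrow> real mat"
  obtains w where "w (n + 1) = e" "\<And>i. i \<in> {1..n} \<Longrightarrow> A i *\<^sub>v w (i + 1) = w i"
proof -
  define s where "s = rec_nat e (\<lambda>m v. A (n - m) *\<^sub>v v)"
  have s: "s 0 = e" "s (Suc m) = A (n - m) *\<^sub>v s m" for m by (simp_all add: s_def)
  have "A i *\<^sub>v s (n + 1 - (i + 1)) = s (n + 1 - i)" if "i \<in> {1..n}" for i
  proof -
    have "n + 1 - i = Suc (n - i)" "n - (n - i) = i" using that by auto
    then show ?thesis using s(2)[of "n - i"] by simp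
  qed
  then show ?thesis using s(1) that[of "\<lambda>i. s (n + 1 - i)"] by simp
qed

lemma row_mult_mat_prod_Suc:
  assumes A: "\<And>i. i \<in> {1..n} \<Longrightarrow> A i \<in> carrier_mat (q i) (q (i + 1))"
    and v: "v \<in> carrier_vec (q 1)" and m: "Suc m \<le> n" and j: "j < q (Suc m + 1)"
  shows "row_mult v (mat_prod (q 1) A (Suc m)) $ j
      = (\<Sum>l<q (m + 1). row_mult v (mat_prod (q 1) A m) $ l * A (Suc m) $$ (l, j))"
proof -
  have "mat_prod (q 1) A m \<in> carrier_mat (q 1) (q (m + 1))"
    using A m by (intro mat_prod_carrier[where n=n]) auto
  then show ?thesis
    unfolding mat_prod.simps using A[of "Suc m"] v m j by (intro row_mult_mult) auto
qed

lemma row_mult_mat_prod_nonneg: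
  assumes A: "\<And>i. i \<in> {1..n} \<Longrightarrow> A i \<in> carrier_mat (q i) (q (i + 1))"
    and A0: "\<And>i l j. i \<in> {1..n} \<Longrightarrow> l < q i \<Longrightarrow> j < q (i + 1) \<Longrightarrow> 0 \<le> A i $$ (l, j)"
    and v: "v \<in> carrier_vec (q 1)" "\<And>l. l < q 1 \<Longrightarrow> 0 \<le> v $ l"
    and "m \<le> n" "j < q (m + 1)"
  shows "0 \<le> row_mult v (mat_prod (q 1) A m) $ j"
  using \<open>m \<le> n\<close> \<open>j < q (m + 1)\<close>
proof (induction m arbitrary: j)
  case 0 then show ?case using v by (simp add: row_mult_one)
next
  case (Suc m)
  have "row_mult v (mat_prod (q 1) A (Suc m)) $ j
      = (\<Sum>l<q (m + 1). row_mult v (mat_prod (q 1) A m) $ l * A (Suc m) $$ (l, j))"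
    using A v(1) Suc.prems by (rule row_mult_mat_prod_Suc)
  also have "\<dots> \<ge> 0"
    using Suc.IH A0 Suc.prems by (intro sum_nonneg mult_nonneg_nonneg) auto
  finally show ?case .
qed

lemma continuous_on_row_mult_mat_prod:
  fixes A :: "nat \<Rightarrow> 'x::topological_space \<Rightarrow> real mat"
  assumes A: "\<And>i x. i \<in> {1..n} \<Longrightarrow> A i x \<in> carrier_mat (q i) (q (i + 1))"
    and cont: "\<And>i l j. i \<in> {1..n} \<Longrightarrow> l < q i \<Longrightarrow> j < q (i + 1) \<Longrightarrow> continuous_on S (\<lambda>x. A i x $$ (l, j))"
    and v: "v \<in> carrier_vec (q 1)" and "m \<le> n" "j < q (m + 1)"
  shows "continuous_on S (\<lambda>x. row_mult v (mat_prod (q 1) (\<lambda>i. A i x) m) $ j)"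
  using \<open>m \<le> n\<close> \<open>j < q (m + 1)\<close>
proof (induction m arbitrary: j)
  case 0 then show ?case by simp
next
  case (Suc m)
  have "row_mult v (mat_prod (q 1) (\<lambda>i. A i x) (Suc m)) $ j
      = (\<Sum>l<q (m + 1). row_mult v (mat_prod (q 1) (\<lambda>i. A i x) m) $ l * A (Suc m) x $$ (l, j))" for x
    using A v Suc.prems by (rule row_mult_mat_prod_Suc)
  moreover have "continuous_on S
      (\<lambda>x. \<Sum>l<q (m + 1). row_mult v (mat_prod (q 1) (\<lambda>i. A i x) m) $ l * A (Suc m) x $$ (l, j))"
    using Suc.IH cont Suc.prems by (intro continuous_on_sum continuous_on_mult) auto
  ultimately show ?case by (simp only:)
qed

text \<open>
  Probabilistically, \<open>(- C)\<^sup>-\<^sup>1 D\<close> contains the transition probabilities from the state in which a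
  block is entered to the state in which the next one is entered.
\<close>

lemma sub_intensity_stochastic:
  assumes C: "sub_intensity p C" and D: "D \<in> carrier_mat p r"
    and e: "- (C *\<^sub>v ones p) = D *\<^sub>v ones r"
  shows "(mat_inv (- C) * D) *\<^sub>v ones r = ones p"
proof -
  have Cc: "C \<in> carrier_mat p p" using C by (simp add: sub_intensity_def)
  have N: "mat_inv (- C) \<in> carrier_mat p p" "mat_inv (- C) * (- C) = 1\<^sub>m p"
    using mat_inv_resolvent(3-5)[OF C, of 0 1] Cc by (simp_all add: resolvent_mat_zero)
  have "(mat_inv (- C) * D) *\<^sub>v ones r = mat_inv (- C) *\<^sub>v (D *\<^sub>v ones r)"
    by (rule assoc_mult_mat_vec[OF N(1) D]) simp
  also have "D *\<^sub>v ones r = (- C) *\<^sub>v ones p" using e Cc by simp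
  also have "mat_inv (- C) *\<^sub>v ((- C) *\<^sub>v ones p) = (mat_inv (- C) * (- C)) *\<^sub>v ones p"
    using assoc_mult_mat_vec[OF N(1), of "- C" p "ones p"] Cc by simp
  also have "\<dots> = ones p" by (simp add: N(2))
  finally show ?thesis .
qed

section \<open>Block bidiagonal linear systems\<close>

text \<open>
  Block \<open>Suc i\<close> starts at the library index \<open>p 1 + \<dots> + p i\<close>.
\<close>

lemma block_index:
  assumes "c < p (Suc i)"
  shows "block_of p ((\<Sum>j=1..i. p j) + c) = Suc i" "offset_of p ((\<Sum>j=1..i. p j) + c) = c"
proof -
  show b: "block_of p ((\<Sum>j=1..i. p j) + c) = Suc i"
    unfolding block_of_def
  proof (rule Least_equality)
    show "(\<Sum>j=1..i. p j) + c < (\<Sum>j=1..Suc i. p j)" using assms by simp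
    fix k assume k: "(\<Sum>j=1..i. p j) + c < (\<Sum>j=1..k. p j)"
    show "Suc i \<le> k"
    proof (rule ccontr)
      assume "\<not> Suc i \<le> k"
      then have "(\<Sum>j=1..k. p j) \<le> (\<Sum>j=1..i. p j)" by (intro sum_mono2) auto
      then show False using k by simp
    qed
  qed
  have "{1..<Suc i} = {1..i}" by auto
  then show "offset_of p ((\<Sum>j=1..i. p j) + c) = c" unfolding offset_of_def b by simp
qed

lemma block_index_exhaust:
  fixes p :: "nat \<Rightarrow> nat"
  assumes "r < (\<Sum>j=1..n. p j)"
  obtains i c where "i < n" "c < p (Suc i)" "r = (\<Sum>j=1..i. p j) + c"
  using assms
proof (induction n arbitrary: thesis)
  case (Suc n)
  show ?case
  proof (cases "r < (\<Sum>j=1..n. p j)")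
    case True then show ?thesis using Suc.IH Suc.prems(1) by (metis less_Suc_eq)
  next
    case False
    then show ?thesis
      using Suc.prems(2) by (intro Suc.prems(1)[of n "r - (\<Sum>j=1..n. p j)"]) auto
  qed
qed auto

lemma sum_lessThan_add:
  fixes g :: "nat \<Rightarrow> 'a::comm_monoid_add"
  shows "(\<Sum>r<a + b. g r) = (\<Sum>r<a. g r) + (\<Sum>c<b. g (a + c))"
  by (induction b) (simp_all add: add_ac)

lemma sum_blocks:
  fixes g :: "nat \<Rightarrow> 'a::comm_monoid_add" and p :: "nat \<Rightarrow> nat"
  shows "(\<Sum>r<(\<Sum>j=1..n. p j). g r) = (\<Sum>i=1..n. \<Sum>c<p i. g ((\<Sum>j=1..i - 1. p j) + c))"
  by (induction n) (simp_all add: sum_lessThan_add)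

lemma block_index_less:
  fixes p :: "nat \<Rightarrow> nat"
  assumes "i < n" "c < p (Suc i)"
  shows "(\<Sum>j=1..i. p j) + c < (\<Sum>j=1..n. p j)"
proof -
  have "(\<Sum>j=1..i. p j) + c < (\<Sum>j=1..Suc i. p j)" using assms by simp
  also have "\<dots> \<le> (\<Sum>j=1..n. p j)" using assms by (intro sum_mono2) auto
  finally show ?thesis .
qed

lemma block_vec_index:
  assumes "i < n" "c < p (Suc i)"
  shows "block_vec n p v $ ((\<Sum>j=1..i. p j) + c) = v (Suc i) $ c"
  using block_index[where p=p, OF assms(2)] block_index_less[where p=p, OF assms] by (simp add: block_vec_def del: One_nat_def)

lemma block_mat_mult_block_vec_index:
  assumes "i < n" "c < p (Suc i)"
  shows "(block_mat n p B *\<^sub>v block_vec n p v) $ ((\<Sum>j=1..i. p j) + c)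
    = (\<Sum>k=1..n. \<Sum>d<p k. B (Suc i) k $$ (c, d) * v k $ d)"
proof -
  let ?N = "\<Sum>j=1..n. p j" and ?r = "(\<Sum>j=1..i. p j) + c"
  have "(block_mat n p B *\<^sub>v block_vec n p v) $ ?r
      = (\<Sum>s<?N. block_mat n p B $$ (?r, s) * block_vec n p v $ s)"
    by (rule mult_mat_vec_index[where r = ?N])
      (use block_index_less[where p=p, OF assms] in \<open>auto simp: block_mat_def block_vec_def\<close>)
  also have "\<dots> = (\<Sum>k=1..n. \<Sum>d<p k. B (Suc i) k $$ (c, d) * v k $ d)"
    unfolding sum_blocks
  proof (intro sum.cong refl)
    fix k d assume "k \<in> {1..n}" "d \<in> {..<p k}"
    then obtain k' where k': "k = Suc k'" "k' < n" "d < p (Suc k')" by (cases k) auto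
    show "block_mat n p B $$ (?r, (\<Sum>j=1..k - 1. p j) + d) * block_vec n p v $ ((\<Sum>j=1..k - 1. p j) + d)
        = B (Suc i) k $$ (c, d) * v k $ d"
      using block_index[where p=p and i=k', OF k'(3)] block_index[where p=p, OF assms(2)] block_index_less[where p=p, OF assms] block_index_less[where p=p, OF k'(2,3)]
      by (simp add: k' block_vec_index block_mat_def del: One_nat_def)
  qed
  finally show ?thesis .
qed

lemma block_vec_first_scalar_prod:
  assumes "n \<ge> 1" "b \<in> carrier_vec (p 1)" "w 1 \<in> carrier_vec (p 1)"
  shows "block_vec n p (\<lambda>i. if i = 1 then b else 0\<^sub>v (p i)) \<bullet> block_vec n p w = b \<bullet> w 1"
proof -
  let ?b = "\<lambda>i. if i = 1 then b else 0\<^sub>v (p i)"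
  have "block_vec n p ?b \<bullet> block_vec n p w
      = (\<Sum>s<(\<Sum>j=1..n. p j). block_vec n p ?b $ s * block_vec n p w $ s)"
    by (simp add: scalar_prod_def atLeast0LessThan block_vec_def)
  also have "\<dots> = (\<Sum>k=1..n. \<Sum>d<p k. ?b k $ d * w k $ d)"
    unfolding sum_blocks
  proof (intro sum.cong refl)
    fix k d assume "k \<in> {1..n}" "d \<in> {..<p k}"
    then obtain k' where k': "k = Suc k'" "k' < n" "d < p (Suc k')" by (cases k) auto
    show "block_vec n p ?b $ ((\<Sum>j=1..k - 1. p j) + d) * block_vec n p w $ ((\<Sum>j=1..k - 1. p j) + d) = ?b k $ d * w k $ d"
      using k' block_vec_index[where p=p, OF k'(2,3)] by (simp del: One_nat_def)
  qed
  also have "\<dots> = (\<Sum>k=1..n. if k = 1 then (\<Sum>d<p 1. b $ d * w 1 $ d) else 0)"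
    by (intro sum.cong) auto
  also have "\<dots> = b \<bullet> w 1"
    using assms by (simp add: scalar_prod_def atLeast0LessThan)
  finally show ?thesis .
qed

lemma block_bidiagonal_row:
  assumes R: "R (Suc i) \<in> carrier_mat (p (Suc i)) (p (Suc i))"
    and D: "Suc i < n \<Longrightarrow> D (Suc i) \<in> carrier_mat (p (Suc i)) (p (Suc (Suc i)))"
    and v: "\<And>j. j \<in> {1..n} \<Longrightarrow> v j \<in> carrier_vec (p j)"
    and i: "i < n" and c: "c < p (Suc i)"
  shows "(block_mat n p (\<lambda>i j. if j = i then R i else if j = i + 1 then - D i else 0\<^sub>m (p i) (p j))
      *\<^sub>v block_vec n p v) $ ((\<Sum>j=1..i. p j) + c)
    = (R (Suc i) *\<^sub>v v (Suc i)) $ c - (if Suc i < n then (D (Suc i) *\<^sub>v v (Suc (Suc i))) $ c else 0)"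
proof -
  let ?B = "\<lambda>i j. if j = i then R i else if j = i + 1 then - D i else 0\<^sub>m (p i) (p j)"
  let ?d = "if Suc i < n then (D (Suc i) *\<^sub>v v (Suc (Suc i))) $ c else 0"
  have Rv: "(\<Sum>d<p (Suc i). R (Suc i) $$ (c, d) * v (Suc i) $ d) = (R (Suc i) *\<^sub>v v (Suc i)) $ c"
    using R v[of "Suc i"] i c by (subst mult_mat_vec_index) auto
  have "(\<Sum>d<p k. ?B (Suc i) k $$ (c, d) * v k $ d)
      = (if k = Suc i then (R (Suc i) *\<^sub>v v (Suc i)) $ c else 0) + (if k = Suc (Suc i) then - ?d else 0)"
    if k: "k \<in> {1..n}" for k
  proof -
    consider "k = Suc i" | "k = Suc (Suc i)" | "k \<noteq> Suc i" "k \<noteq> Suc (Suc i)" by blast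
    then show ?thesis
    proof cases
      case 2
      then have lt: "Suc i < n" using k by simp
      have "(D (Suc i) *\<^sub>v v (Suc (Suc i))) $ c = (\<Sum>d<p (Suc (Suc i)). D (Suc i) $$ (c, d) * v (Suc (Suc i)) $ d)"
        using D[OF lt] v[of "Suc (Suc i)"] lt c by (intro mult_mat_vec_index) auto
      then show ?thesis using 2 lt D[OF lt] c by (simp add: sum_negf)
    qed (use Rv c in auto)
  qed
  then have "(\<Sum>k=1..n. \<Sum>d<p k. ?B (Suc i) k $$ (c, d) * v k $ d)
      = (\<Sum>k=1..n. (if k = Suc i then (R (Suc i) *\<^sub>v v (Suc i)) $ c else 0) + (if k = Suc (Suc i) then - ?d else 0))"
    by (intro sum.cong) auto
  also have "\<dots> = (R (Suc i) *\<^sub>v v (Suc i)) $ c - ?d"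
    using i by (simp add: sum.distrib)
  finally show ?thesis
    using block_mat_mult_block_vec_index[where p=p, OF i c, where B = ?B and v = v] by (simp del: One_nat_def)
qed

text \<open>
  A vector \<open>w\<close> obtained by back substitution solves the system. It is the value of the inverse because
  the matrix is injective: in a kernel vector the blocks vanish successively from the last to the first.
\<close>

lemma block_bidiagonal_solution:
  assumes R: "\<And>i. i \<in> {1..n} \<Longrightarrow> R i \<in> carrier_mat (p i) (p i)"
    and inj: "\<And>i v. i \<in> {1..n} \<Longrightarrow> v \<in> carrier_vec (p i) \<Longrightarrow> R i *\<^sub>v v = 0\<^sub>v (p i) \<Longrightarrow> v = 0\<^sub>v (p i)"
    and D: "\<And>i. i \<in> {1..<n} \<Longrightarrow> D i \<in> carrier_mat (p i) (p (i + 1))"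
    and w: "\<And>i. i \<in> {1..n} \<Longrightarrow> w i \<in> carrier_vec (p i)"
    and step: "\<And>i. i \<in> {1..<n} \<Longrightarrow> R i *\<^sub>v w i = D i *\<^sub>v w (i + 1)"
    and last: "R n *\<^sub>v w n = b"
  shows "mat_inv (block_mat n p (\<lambda>i j. if j = i then R i else if j = i + 1 then - D i else 0\<^sub>m (p i) (p j)))
      *\<^sub>v block_vec n p (\<lambda>i. if i = n then b else 0\<^sub>v (p i)) = block_vec n p w"
proof -
  let ?N = "\<Sum>j=1..n. p j"
  define B where "B = block_mat n p (\<lambda>i j. if j = i then R i else if j = i + 1 then - D i else 0\<^sub>m (p i) (p j))"
  have Bc: "B \<in> carrier_mat ?N ?N" by (simp add: B_def block_mat_def)
  have row: "(B *\<^sub>v block_vec n p v) $ ((\<Sum>j=1..i. p j) + c)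
    = (R (Suc i) *\<^sub>v v (Suc i)) $ c - (if Suc i < n then (D (Suc i) *\<^sub>v v (Suc (Suc i))) $ c else 0)"
    if "i < n" "c < p (Suc i)" "\<And>j. j \<in> {1..n} \<Longrightarrow> v j \<in> carrier_vec (p j)" for i c v
    unfolding B_def using R[of "Suc i"] D[of "Suc i"] that by (intro block_bidiagonal_row) auto
  have Binj: "y = 0\<^sub>v ?N" if y: "y \<in> carrier_vec ?N" and By: "B *\<^sub>v y = 0\<^sub>v ?N" for y
  proof -
    \<comment> \<open>the blocks of \<open>y\<close>\<close>
    define v where "v i = vec (p i) (\<lambda>c. y $ ((\<Sum>j=1..i - 1. p j) + c))" for i
    have vc: "v i \<in> carrier_vec (p i)" for i by (simp add: v_def)
    have yv: "y = block_vec n p v"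
    proof (rule eq_vecI)
      show "dim_vec y = dim_vec (block_vec n p v)" using y by (simp add: block_vec_def)
      fix r assume "r < dim_vec (block_vec n p v)"
      then have "r < ?N" by (simp add: block_vec_def)
      then obtain i c where "i < n" "c < p (Suc i)" "r = (\<Sum>j=1..i. p j) + c"
        by (rule block_index_exhaust)
      then show "y $ r = block_vec n p v $ r" by (simp add: block_vec_index v_def del: One_nat_def)
    qed
    have Byv: "B *\<^sub>v block_vec n p v = 0\<^sub>v ?N" using By by (simp flip: yv)
    \<comment> \<open>back substitution, counting blocks from the last one\<close>
    have v0: "v (n - k) = 0\<^sub>v (p (n - k))" if "k < n" for k
      using that
    proof (induction k)
      case 0
      have "R n *\<^sub>v v n = 0\<^sub>v (p n)"
      proof (rule eq_vecI)
        fix c assume "c < dim_vec (0\<^sub>v (p n) :: real vec)"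
        then have c: "c < p (Suc (n - 1))" using 0 by simp
        have "n - 1 < n" "Suc (n - 1) = n" using 0 by auto
        with row[OF _ c, of v, unfolded Byv] vc
        have "0\<^sub>v ?N $ ((\<Sum>j=1..n - 1. p j) + c) = (R n *\<^sub>v v n) $ c"
          by (simp del: index_mult_mat_vec index_zero_vec One_nat_def)
        then show "(R n *\<^sub>v v n) $ c = 0\<^sub>v (p n) $ c"
          using block_index_less[of "n - 1" n c p] c 0 by simp
      qed (use R[of n] 0 in auto)
      then show ?case using inj[of n "v n"] vc 0 by simp
    next
      case (Suc k)
      define m where "m = n - Suc k"
      have m: "m \<in> {1..<n}" "m \<in> {1..n}" "n - k = Suc m" using Suc.prems by (auto simp: m_def)
      have vm: "v (Suc m) = 0\<^sub>v (p (Suc m))" using Suc m by simp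
      have "R m *\<^sub>v v m = 0\<^sub>v (p m)"
      proof (rule eq_vecI)
        fix c assume "c < dim_vec (0\<^sub>v (p m) :: real vec)"
        then have c: "c < p (Suc (m - 1))" using m by simp
        have "0\<^sub>v ?N $ ((\<Sum>j=1..m - 1. p j) + c) = (R m *\<^sub>v v m) $ c - (D m *\<^sub>v v (Suc m)) $ c"
          using row[OF _ c, of v, unfolded Byv] vc m by (simp del: index_mult_mat_vec index_zero_vec One_nat_def)
        moreover have "(D m *\<^sub>v v (Suc m)) $ c = 0" using vm D[of m] m c by simp
        ultimately show "(R m *\<^sub>v v m) $ c = 0\<^sub>v (p m) $ c"
          using block_index_less[of "m - 1" n c p] c m by simp
      qed (use R[of m] m in auto)
      then show ?case using inj[of m "v m"] vc m by (simp add: m_def)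
    qed
    have v0': "v i = 0\<^sub>v (p i)" if "i \<in> {1..n}" for i
      using v0[of "n - i"] that by (cases "i = 0") auto
    show ?thesis
    proof (rule eq_vecI)
      fix r assume "r < dim_vec (0\<^sub>v ?N :: real vec)"
      then have "r < ?N" by simp
      then obtain i c where ic: "i < n" "c < p (Suc i)" "r = (\<Sum>j=1..i. p j) + c"
        by (rule block_index_exhaust)
      then show "y $ r = 0\<^sub>v ?N $ r"
        using v0'[of "Suc i"] block_index_less[of i n c p] by (simp add: yv block_vec_index del: One_nat_def)
    qed (use y in simp)
  qed
  note Bi = mat_inv_of_injective[OF Bc Binj]
  have wN: "block_vec n p w \<in> carrier_vec ?N" by (simp add: block_vec_def)
  have "B *\<^sub>v block_vec n p w = block_vec n p (\<lambda>i. if i = n then b else 0\<^sub>v (p i))"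
  proof (rule eq_vecI)
    fix r assume "r < dim_vec (block_vec n p (\<lambda>i. if i = n then b else 0\<^sub>v (p i)))"
    then have "r < ?N" by (simp add: block_vec_def)
    then obtain i c where ic: "i < n" "c < p (Suc i)" "r = (\<Sum>j=1..i. p j) + c"
      by (rule block_index_exhaust)
    show "(B *\<^sub>v block_vec n p w) $ r = block_vec n p (\<lambda>i. if i = n then b else 0\<^sub>v (p i)) $ r"
    proof (cases "Suc i < n")
      case True
      then have "R (Suc i) *\<^sub>v w (Suc i) = D (Suc i) *\<^sub>v w (Suc (Suc i))"
        using step[of "Suc i"] by simp
      then show ?thesis using True row[OF ic(1,2) w] ic
        by (simp add: block_vec_index del: index_mult_mat_vec One_nat_def)
    next
      case False
      then have "Suc i = n" using ic by simp
      then show ?thesis using row[OF ic(1,2) w] last ic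
        by (simp add: block_vec_index del: index_mult_mat_vec One_nat_def)
    qed
  qed (use Bc in \<open>simp add: block_vec_def\<close>)
  then have "mat_inv B *\<^sub>v block_vec n p (\<lambda>i. if i = n then b else 0\<^sub>v (p i)) = mat_inv B *\<^sub>v (B *\<^sub>v block_vec n p w)"
    by simp
  also have "\<dots> = block_vec n p w"
    using Bi(1,3) Bc wN by (simp flip: assoc_mult_mat_vec)
  finally show ?thesis by (simp add: B_def)
qed

section \<open>Integrating matrix products over independent coordinates\<close>

lemma has_bochner_integral_PiM_insert_mult:
  fixes h :: "('i \<Rightarrow> real) \<Rightarrow> real" and g :: "real \<Rightarrow> real"
  assumes I: "finite I" "i \<notin> I"
    and h: "has_bochner_integral (\<Pi>\<^sub>M i\<in>I. lborel) h a"
    and g: "has_bochner_integral lborel g b"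
  shows "has_bochner_integral (\<Pi>\<^sub>M i\<in>insert i I. lborel) (\<lambda>x. h (restrict x I) * g (x i)) (a * b)"
proof -
  interpret product_sigma_finite "\<lambda>_::'i. lborel :: real measure" ..
  have hi: "integrable (\<Pi>\<^sub>M i\<in>I. lborel) h" and ha: "integral\<^sup>L (\<Pi>\<^sub>M i\<in>I. lborel) h = a"
    using h by (auto simp: has_bochner_integral_iff)
  have gi: "integrable lborel g" and gb: "integral\<^sup>L lborel g = b"
    using g by (auto simp: has_bochner_integral_iff)
  have [measurable]: "g \<in> borel_measurable borel" using borel_measurable_integrable[OF gi] by simp
  have [measurable]: "h \<in> borel_measurable (\<Pi>\<^sub>M i\<in>I. lborel)" by (rule borel_measurable_integrable[OF hi])
  let ?P = "\<Pi>\<^sub>M i\<in>insert i I. lborel :: real measure"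
  let ?f = "\<lambda>x. h (restrict x I) * g (x i)"
  have [measurable]: "(\<lambda>x. restrict x I) \<in> measurable ?P (\<Pi>\<^sub>M i\<in>I. lborel)"
    by (rule measurable_restrict_subset) auto
  have upd: "?f (x(i := y)) = h x * g y" if "x \<in> space (\<Pi>\<^sub>M i\<in>I. lborel)" for x y
  proof -
    have "restrict (x(i := y)) I = x"
      using that I by (auto simp: space_PiM restrict_def PiE_def extensional_def fun_eq_iff)
    then show ?thesis by simp
  qed
  have meas: "?f \<in> borel_measurable ?P" by measurable
  have "(\<integral>\<^sup>+x. norm (?f x) \<partial>?P) = (\<integral>\<^sup>+x. (\<integral>\<^sup>+y. norm (?f (x(i := y))) \<partial>lborel) \<partial>(\<Pi>\<^sub>M i\<in>I. lborel))"
    by (rule product_nn_integral_insert[OF I]) (use meas in measurable)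
  also have "\<dots> = (\<integral>\<^sup>+x. (\<integral>\<^sup>+y. ennreal (norm (h x)) * ennreal (norm (g y)) \<partial>lborel) \<partial>(\<Pi>\<^sub>M i\<in>I. lborel))"
    by (intro nn_integral_cong) (simp only: upd norm_mult ennreal_mult norm_ge_zero)
  also have "\<dots> = (\<integral>\<^sup>+x. norm (h x) \<partial>(\<Pi>\<^sub>M i\<in>I. lborel)) * (\<integral>\<^sup>+y. norm (g y) \<partial>lborel)"
    by (simp add: nn_integral_cmult nn_integral_multc)
  also have "\<dots> < \<infinity>"
    using hi gi by (simp add: integrable_iff_bounded ennreal_mult_less_top)
  finally have int: "integrable ?P ?f"
    using meas by (intro integrableI_bounded) auto
  have "integral\<^sup>L ?P ?f = (\<integral>x. (\<integral>y. ?f (x(i := y)) \<partial>lborel) \<partial>(\<Pi>\<^sub>M i\<in>I. lborel))"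
    by (rule product_integral_insert[OF I int])
  also have "\<dots> = (\<integral>x. (\<integral>y. h x * g y \<partial>lborel) \<partial>(\<Pi>\<^sub>M i\<in>I. lborel))"
    by (intro Bochner_Integration.integral_cong refl) (simp only: upd)
  also have "\<dots> = a * b" by (simp add: gb ha)
  finally show ?thesis using int by (simp add: has_bochner_integral_iff)
qed

text \<open>
  The \<open>m\<close>-th factor depends on the \<open>m\<close>-th coordinate only, and the partial product on the
  preceding ones, so integration commutes with each matrix multiplication.
\<close>

lemma has_bochner_integral_row_mult_mat_prod:
  fixes A :: "nat \<Rightarrow> real \<Rightarrow> real mat"
  assumes A: "\<And>i t. i \<in> {1..n} \<Longrightarrow> A i t \<in> carrier_mat (q i) (q (i + 1))"
    and R: "\<And>i. i \<in> {1..n} \<Longrightarrow> R i \<in> carrier_mat (q i) (q (i + 1))"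
    and int: "\<And>i l j. i \<in> {1..n} \<Longrightarrow> l < q i \<Longrightarrow> j < q (i + 1) \<Longrightarrow>
      has_bochner_integral lborel (\<lambda>t. A i t $$ (l, j)) (R i $$ (l, j))"
    and v: "v \<in> carrier_vec (q 1)" and "m \<le> n" and "j < q (m + 1)"
  shows "has_bochner_integral (\<Pi>\<^sub>M i\<in>{1..m}. lborel)
    (\<lambda>x. row_mult v (mat_prod (q 1) (\<lambda>i. A i (x i)) m) $ j) (row_mult v (mat_prod (q 1) R m) $ j)"
  using \<open>m \<le> n\<close> \<open>j < q (m + 1)\<close>
proof (induction m arbitrary: j)
  case 0
  interpret E: prob_space "\<Pi>\<^sub>M i\<in>({} :: nat set). lborel :: real measure"
    by (rule prob_spaceI) (simp add: space_PiM)
  have "has_bochner_integral (\<Pi>\<^sub>M i\<in>({} :: nat set). lborel :: real measure) (\<lambda>x. c) c" for c :: real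
    using E.integrable_const[of c] E.prob_space by (simp add: has_bochner_integral_iff)
  then show ?case by simp
next
  case (Suc m)
  define r where "r x l = row_mult v (mat_prod (q 1) (\<lambda>i. A i (x i)) m) $ l" for x :: "nat \<Rightarrow> real" and l
  have r_restrict: "r (restrict x {1..m}) l = r x l" for x l
  proof -
    have "mat_prod (q 1) (\<lambda>i. A i (restrict x {1..m} i)) m = mat_prod (q 1) (\<lambda>i. A i (x i)) m"
      by (rule mat_prod_cong) simp
    then show ?thesis by (simp add: r_def)
  qed
  have "has_bochner_integral (\<Pi>\<^sub>M i\<in>insert (Suc m) {1..m}. lborel)
      (\<lambda>x. \<Sum>l<q (m + 1). r (restrict x {1..m}) l * A (Suc m) (x (Suc m)) $$ (l, j))
      (\<Sum>l<q (m + 1). row_mult v (mat_prod (q 1) R m) $ l * R (Suc m) $$ (l, j))"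
  proof (rule has_bochner_integral_sum)
    fix l assume "l \<in> {..<q (m + 1)}"
    then have l: "l < q (m + 1)" by simp
    show "has_bochner_integral (\<Pi>\<^sub>M i\<in>insert (Suc m) {1..m}. lborel)
      (\<lambda>x. r (restrict x {1..m}) l * A (Suc m) (x (Suc m)) $$ (l, j))
      (row_mult v (mat_prod (q 1) R m) $ l * R (Suc m) $$ (l, j))"
      using Suc.IH[of l] int[of "Suc m" l j] Suc.prems l
      by (intro has_bochner_integral_PiM_insert_mult[where h="\<lambda>x. r x l" and g="\<lambda>t. A (Suc m) t $$ (l, j)"])
        (auto simp: r_def[abs_def])
  qed
  moreover have "insert (Suc m) {1..m} = {1..Suc m}" by auto
  ultimately show ?case
    
    using row_mult_mat_prod_Suc[where A = "\<lambda>i. A i (x i)" and q = q for x, OF A v Suc.prems]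
      row_mult_mat_prod_Suc[where A = R and q = q, OF R v Suc.prems]
    by (simp only: r_restrict) (simp only: r_def)
qed

section \<open>Densities recognised by their Laplace transform\<close>

lemma emeasure_lborel_open_pos:
  fixes U :: "real set"
  assumes "open U" "t \<in> U"
  shows "emeasure lborel U \<noteq> 0"
proof -
  obtain e where e: "e > 0" "ball t e \<subseteq> U" using assms open_contains_ball by metis
  have "{t - e <..< t + e} \<subseteq> U" using e by (simp add: ball_eq_greaterThanLessThan)
  then have "emeasure lborel {t - e <..< t + e} \<le> emeasure lborel U"
    using assms by (intro emeasure_mono) auto
  then show ?thesis using e by auto
qed

text \<open>
  Multiplication with \<open>w x = exp (- c * (\<Sum>i\<in>I. x i))\<close> makes \<open>f\<close> integrable, and turns the
  hypothesis into equality of two Laplace transforms at all natural numbers. Uniqueness for signed weights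
  identifies the tilted law of \<open>X\<close> with the tilted \<open>f\<close>; testing this on the set where \<open>f\<close> is
  negative shows that this set is null. A continuous function that is negative at a point of the orthant would
  be negative on a box of positive measure, because \<open>f\<close> depends on the coordinates in \<open>I\<close> only.
  Finally the tilt is undone.
\<close>

lemma density_of_laplace_transform:
  fixes X :: "'i \<Rightarrow> 'w \<Rightarrow> real" and f :: "('i \<Rightarrow> real) \<Rightarrow> real"
  assumes "prob_space M" and I: "finite I" and c: "c \<ge> 0"
    and X [measurable]: "\<And>i. i \<in> I \<Longrightarrow> X i \<in> borel_measurable M"
    and X0: "\<And>i \<omega>. i \<in> I \<Longrightarrow> \<omega> \<in> space M \<Longrightarrow> 0 \<le> X i \<omega>"
    and laplace: "\<And>k :: 'i \<Rightarrow> nat. has_bochner_integral (\<Pi>\<^sub>M i\<in>I. lborel)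
      (\<lambda>x. (\<Prod>i\<in>I. indicator {0<..} (x i) * exp (- ((c + real (k i)) * x i))) * f x)
      (\<integral>\<omega>. exp (- (\<Sum>i\<in>I. (c + real (k i)) * X i \<omega>)) \<partial>M)"
    and cont: "continuous_on {x. \<forall>i\<in>I. 0 < x i} f"
    and local: "\<And>x y. (\<And>i. i \<in> I \<Longrightarrow> x i = y i) \<Longrightarrow> f x = f y"
  shows "\<And>x. (\<And>i. i \<in> I \<Longrightarrow> 0 < x i) \<Longrightarrow> 0 \<le> f x"
    and "distributed M (\<Pi>\<^sub>M i\<in>I. lborel) (\<lambda>\<omega>. \<lambda>i\<in>I. X i \<omega>)
      (\<lambda>x. if \<forall>i\<in>I. 0 < x i then ennreal (f x) else 0)"
proof -
  interpret prob_space M by fact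
  interpret product_sigma_finite "\<lambda>_::'i. lborel :: real measure" ..
  let ?L = "\<Pi>\<^sub>M i\<in>I. lborel :: real measure"
  let ?Y = "\<lambda>\<omega>. \<lambda>i\<in>I. X i \<omega>"
  let ?S = "{x :: 'i \<Rightarrow> real. \<forall>i\<in>I. 0 < x i}"
  have sets_L: "sets ?L = sets (\<Pi>\<^sub>M i\<in>I. borel)" by (intro sets_PiM_cong) auto
  have Y [measurable]: "?Y \<in> measurable M ?L" by measurable
  define w where "w x = exp (- (\<Sum>i\<in>I. c * x i))" for x :: "'i \<Rightarrow> real"
  define V where "V \<omega> = w (\<lambda>i. X i \<omega>)" for \<omega>
  define W where "W x = (if x \<in> ?S then w x * f x else 0)" for x
  have w_pos: "w x > 0" for x by (simp add: w_def)
  have wm [measurable]: "w \<in> borel_measurable ?L" unfolding w_def by measurable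
  have Vm [measurable]: "V \<in> borel_measurable M" unfolding V_def w_def by measurable
  have split: "(\<Prod>i\<in>I. indicator {0<..} (x i) * exp (- ((c + real (k i)) * x i))) * f x
      = W x * exp (- (\<Sum>i\<in>I. real (k i) * x i))" for x k
  proof (cases "x \<in> ?S")
    case True
    then have "(\<Prod>i\<in>I. indicator {0<..} (x i) * exp (- ((c + real (k i)) * x i)))
        = (\<Prod>i\<in>I. exp (- (c * x i)) * exp (- (real (k i) * x i)))"
      by (intro prod.cong) (auto simp: algebra_simps exp_add[symmetric])
    also have "\<dots> = w x * exp (- (\<Sum>i\<in>I. real (k i) * x i))"
      using I by (simp add: w_def exp_sum prod.distrib flip: sum_negf)
    finally show ?thesis using True by (simp add: W_def)
  next
    case False
    then obtain i where "i \<in> I" "\<not> 0 < x i" by auto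
    then have "(\<Prod>i\<in>I. indicator {0<..} (x i) * exp (- ((c + real (k i)) * x i))) = 0"
      using I by (intro prod_zero bexI[of _ i]) auto
    then show ?thesis using False by (auto simp: W_def)
  qed
  have W: "integrable ?L W"
    using laplace[of "\<lambda>_. 0"] unfolding split by (simp add: has_bochner_integral_iff)
  note [measurable] = borel_measurable_integrable[OF W]
  have V: "integrable M V"
  proof (rule integrable_const_bound[where B = 1])
    show "AE \<omega> in M. norm (V \<omega>) \<le> 1"
      using c X0 by (auto simp: V_def w_def intro!: sum_nonneg)
  qed measurable
  have eq: "(\<integral>\<omega>. V \<omega> * indicator A (?Y \<omega>) \<partial>M) = (\<integral>x. W x * indicator A x \<partial>?L)"
    if A: "A \<in> sets ?L" for A
  proof -
    have "(\<integral>\<omega>. V \<omega> * indicator A (?Y \<omega>) \<partial>M) = (\<integral>x. W x * indicator A (\<lambda>i\<in>I. x i) \<partial>?L)"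
    proof (rule laplace_transform_determines_integrals[OF I V W])
      fix k :: "'i \<Rightarrow> nat"
      have "(\<integral>\<omega>. V \<omega> * exp (- (\<Sum>i\<in>I. real (k i) * X i \<omega>)) \<partial>M)
          = (\<integral>\<omega>. exp (- (\<Sum>i\<in>I. (c + real (k i)) * X i \<omega>)) \<partial>M)"
        by (simp add: V_def w_def distrib_right sum.distrib flip: exp_add)
      also have "\<dots> = (\<integral>x. W x * exp (- (\<Sum>i\<in>I. real (k i) * x i)) \<partial>?L)"
        using laplace[of k] unfolding split by (simp add: has_bochner_integral_iff)
      finally show "(\<integral>\<omega>. V \<omega> * exp (- (\<Sum>i\<in>I. real (k i) * X i \<omega>)) \<partial>M)
          = (\<integral>x. W x * exp (- (\<Sum>i\<in>I. real (k i) * x i)) \<partial>?L)" .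
      show "0 \<le> x i" if "i \<in> I" "W x \<noteq> 0" for i x
        using that by (auto simp: W_def less_imp_le split: if_splits)
      show "A \<in> sets (\<Pi>\<^sub>M i\<in>I. borel)" using A sets_L by simp
    qed (use X X0 in auto)
    also have "\<dots> = (\<integral>x. W x * indicator A x \<partial>?L)"
      by (intro Bochner_Integration.integral_cong refl) (auto simp: space_PiM PiE_restrict)
    finally show ?thesis .
  qed
  have W_AE: "AE x in ?L. 0 \<le> W x"
  proof -
    define A where "A = {x \<in> space ?L. W x < 0}"
    have A: "A \<in> sets ?L" unfolding A_def by measurable
    have int: "integrable ?L (\<lambda>x. W x * indicator A x)"
      using integrable_mult_indicator[OF A W] by (simp add: mult.commute)
    have "0 \<le> (\<integral>\<omega>. V \<omega> * indicator A (?Y \<omega>) \<partial>M)"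
      using w_pos by (intro integral_nonneg_AE) (auto simp: V_def less_imp_le)
    then have "(\<integral>x. - (W x * indicator A x) \<partial>?L) \<le> 0" using eq[OF A] by simp
    moreover have nn: "0 \<le> - (W x * indicator A x)" for x
      by (auto simp: A_def indicator_def)
    then have "0 \<le> (\<integral>x. - (W x * indicator A x) \<partial>?L)" by (intro integral_nonneg_AE) auto
    ultimately have "(\<integral>x. - (W x * indicator A x) \<partial>?L) = 0" by simp
    then have "AE x in ?L. - (W x * indicator A x) = 0"
      using int nn by (subst (asm) integral_nonneg_eq_0_iff_AE) auto
    then show ?thesis
    proof (rule AE_mp)
      show "AE x in ?L. - (W x * indicator A x) = 0 \<longrightarrow> 0 \<le> W x"
        by (auto simp: A_def indicator_def)
    qed
  qed
  show f_nonneg: "0 \<le> f x" if x: "\<And>i. i \<in> I \<Longrightarrow> 0 < x i" for x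
  proof (rule ccontr)
    assume "\<not> 0 \<le> f x"
    have S_eq: "?S = (\<Inter>i\<in>I. (\<lambda>x. x i) -` {0<..})" by auto
    have "open ((\<lambda>x :: 'i \<Rightarrow> real. x i) -` {0<..})" for i
      by (rule open_vimage[OF open_greaterThan continuous_on_product_coordinates])
    then have "open ?S" unfolding S_eq using I by (intro open_INT) auto
    then have "open (?S \<inter> f -` {..<0})" by (rule continuous_open_preimage[OF cont _ open_lessThan])
    moreover have "x \<in> ?S \<inter> f -` {..<0}" using x \<open>\<not> 0 \<le> f x\<close> by auto
    ultimately obtain U where U: "x \<in> Pi\<^sub>E UNIV U" "\<And>i. open (U i)" "Pi\<^sub>E UNIV U \<subseteq> ?S \<inter> f -` {..<0}"
      using product_topology_open_contains_basis[of "\<lambda>_. euclidean" UNIV "?S \<inter> f -` {..<0}" x]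
      by (auto simp: open_fun_def)
    have box: "Pi\<^sub>E I U \<in> sets ?L" using U(2) I by (intro sets_PiM_I_finite) auto
    have neg: "W y < 0" if y: "y \<in> Pi\<^sub>E I U" for y
    proof -
      \<comment> \<open>points of the product measure are \<open>undefined\<close> outside \<open>I\<close>, unlike those near \<open>x\<close>\<close>
      define y' where "y' i = (if i \<in> I then y i else x i)" for i
      have "y' \<in> Pi\<^sub>E UNIV U" using y U(1) by (auto simp: y'_def PiE_iff)
      then have "y' \<in> ?S" "f y' < 0" using U(3) by auto
      moreover have "f y' = f y" by (rule local) (simp add: y'_def)
      moreover have "y \<in> ?S" using \<open>y' \<in> ?S\<close> by (auto simp: y'_def)
      ultimately show ?thesis using w_pos[of y] by (simp add: W_def mult_pos_neg)
    qed
    have "AE y in ?L. y \<notin> Pi\<^sub>E I U" using W_AE by eventually_elim (use neg in force)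
    moreover have "{y \<in> space ?L. \<not> y \<notin> Pi\<^sub>E I U} = Pi\<^sub>E I U"
      using sets.sets_into_space[OF box] by auto
    ultimately have "emeasure ?L (Pi\<^sub>E I U) = 0"
      using AE_iff_measurable[OF box, of "\<lambda>y. y \<notin> Pi\<^sub>E I U"] by simp
    moreover have "emeasure ?L (Pi\<^sub>E I U) = (\<Prod>i\<in>I. emeasure lborel (U i))"
      using U(2) by (intro emeasure_PiM I) auto
    moreover have "emeasure lborel (U i) \<noteq> 0" for i
      using U(1,2) by (intro emeasure_lborel_open_pos[of _ "x i"]) auto
    ultimately show False using I by (simp add: prod_zero_iff)
  qed
  have W_nonneg: "0 \<le> W x" for x
    using f_nonneg[of x] w_pos[of x] by (auto simp: W_def less_imp_le)
  have V_nonneg: "0 \<le> V \<omega>" for \<omega> using w_pos by (simp add: V_def less_imp_le)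
  have tilted: "distr (density M (\<lambda>\<omega>. ennreal (V \<omega>))) ?L ?Y = density ?L (\<lambda>x. ennreal (W x))"
  proof (rule measure_eqI)
    fix A assume "A \<in> sets (distr (density M (\<lambda>\<omega>. ennreal (V \<omega>))) ?L ?Y)"
    then have A [measurable]: "A \<in> sets ?L" by simp
    have "emeasure (distr (density M (\<lambda>\<omega>. ennreal (V \<omega>))) ?L ?Y) A
        = (\<integral>\<^sup>+\<omega>. ennreal (V \<omega> * indicator A (?Y \<omega>)) \<partial>M)"
      by (subst emeasure_distr, simp, simp, subst emeasure_density)
        (auto intro!: nn_integral_cong simp: indicator_def)
    also have "\<dots> = ennreal (\<integral>\<omega>. V \<omega> * indicator A (?Y \<omega>) \<partial>M)"
    proof (rule nn_integral_eq_integral)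
      show "integrable M (\<lambda>\<omega>. V \<omega> * indicator A (?Y \<omega>))"
        by (rule Bochner_Integration.integrable_bound[OF V]) (auto simp: indicator_def)
    qed (use V_nonneg in auto)
    also have "\<dots> = ennreal (\<integral>x. W x * indicator A x \<partial>?L)" by (simp only: eq[OF A])
    also have "\<dots> = (\<integral>\<^sup>+x. ennreal (W x * indicator A x) \<partial>?L)"
    proof (rule nn_integral_eq_integral[symmetric])
      show "integrable ?L (\<lambda>x. W x * indicator A x)"
        by (rule Bochner_Integration.integrable_bound[OF W]) (auto simp: indicator_def)
    qed (use W_nonneg in auto)
    also have "\<dots> = emeasure (density ?L (\<lambda>x. ennreal (W x))) A"
      by (subst emeasure_density) (auto intro!: nn_integral_cong simp: indicator_def)
    finally show "emeasure (distr (density M (\<lambda>\<omega>. ennreal (V \<omega>))) ?L ?Y) A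
        = emeasure (density ?L (\<lambda>x. ennreal (W x))) A" .
  qed simp
  let ?g = "\<lambda>x. if \<forall>i\<in>I. 0 < x i then ennreal (f x) else 0"
  have g_eq: "?g x = ennreal (1 / w x) * ennreal (W x)" for x
    using w_pos[of x] by (auto simp: W_def simp flip: ennreal_mult')
  have gm: "?g \<in> borel_measurable ?L" unfolding g_eq by measurable
  have "distr M ?L ?Y = density ?L ?g"
  proof (rule measure_eqI)
    fix A assume "A \<in> sets (distr M ?L ?Y)"
    then have A [measurable]: "A \<in> sets ?L" by simp
    have wY: "w (?Y \<omega>) = V \<omega>" for \<omega> by (simp add: w_def V_def)
    have "emeasure (distr M ?L ?Y) A = (\<integral>\<^sup>+\<omega>. indicator A (?Y \<omega>) \<partial>M)"
      by (simp add: nn_integral_indicator[symmetric] nn_integral_distr del: nn_integral_indicator)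
    also have "\<dots> = (\<integral>\<^sup>+\<omega>. ennreal (V \<omega>) * (ennreal (1 / w (?Y \<omega>)) * indicator A (?Y \<omega>)) \<partial>M)"
    proof (intro nn_integral_cong)
      fix \<omega>
      have "V \<omega> > 0" using w_pos by (simp add: V_def)
      then have "ennreal (V \<omega>) * ennreal (1 / w (?Y \<omega>)) = 1" unfolding wY by (simp flip: ennreal_mult)
      then show "indicator A (?Y \<omega>) = ennreal (V \<omega>) * (ennreal (1 / w (?Y \<omega>)) * indicator A (?Y \<omega>))"
        by (simp add: mult.assoc[symmetric])
    qed
    also have "\<dots> = (\<integral>\<^sup>+x. ennreal (1 / w x) * indicator A x \<partial>distr (density M (\<lambda>\<omega>. ennreal (V \<omega>))) ?L ?Y)"
      by (subst nn_integral_distr, simp, simp, subst nn_integral_density) auto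
    also have "\<dots> = (\<integral>\<^sup>+x. ennreal (W x) * (ennreal (1 / w x) * indicator A x) \<partial>?L)"
      unfolding tilted by (subst nn_integral_density) auto
    also have "\<dots> = (\<integral>\<^sup>+x. ?g x * indicator A x \<partial>?L)"
      by (intro nn_integral_cong) (simp only: g_eq mult_ac)
    also have "\<dots> = emeasure (density ?L ?g) A"
      using gm by (subst emeasure_density) auto
    finally show "emeasure (distr M ?L ?Y) A = emeasure (density ?L ?g) A" .
  qed simp
  then show "distributed M ?L ?Y ?g" using Y gm by (simp add: distributed_def)
qed

section \<open>Chains of Mittag-Leffler blocks\<close>

text \<open>
  The sizes \<open>q 1, \<dots>, q n\<close> of the blocks are continued by the number \<open>q (n + 1)\<close> of columns of the last
  matrix \<open>D n\<close>. Then \<open>D i\<close> is a \<open>q i\<close> by \<open>q (i + 1)\<close> matrix for all \<open>i\<close>, and the last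
  block is no exception.
\<close>

locale mml_chain =
  fixes n :: nat and \<alpha> :: "nat \<Rightarrow> real" and q :: "nat \<Rightarrow> nat" and C D :: "nat \<Rightarrow> real mat"
    and v :: "real vec"
  assumes n: "n \<ge> 1"
    and \<alpha>: "\<And>i. i \<in> {1..n} \<Longrightarrow> 0 < \<alpha> i"
    and C: "\<And>i. i \<in> {1..n} \<Longrightarrow> sub_intensity (q i) (C i)"
    and D: "\<And>i. i \<in> {1..n} \<Longrightarrow> D i \<in> carrier_mat (q i) (q (i + 1))"
    and D0: "\<And>i. i \<in> {1..n} \<Longrightarrow> nonneg_mat (D i)"
    and CD: "\<And>i. i \<in> {1..n} \<Longrightarrow> - (C i *\<^sub>v ones (q i)) = D i *\<^sub>v ones (q (i + 1))"
    and v: "prob_vec (q 1) v"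
begin

definition factor :: "(nat \<Rightarrow> real) \<Rightarrow> nat \<Rightarrow> real mat" where
  "factor u i = mat_inv (resolvent_mat (u i) (\<alpha> i) (C i)) * D i"

definition kernel :: "nat \<Rightarrow> real \<Rightarrow> real mat" where
  "kernel i t = (t powr (\<alpha> i - 1)) \<cdot>\<^sub>m (mittag_leffler (\<alpha> i) (\<alpha> i) ((t powr \<alpha> i) \<cdot>\<^sub>m C i) * D i)"

lemma C_carrier: "i \<in> {1..n} \<Longrightarrow> C i \<in> carrier_mat (q i) (q i)"
  using C by (simp add: sub_intensity_def)

lemma v_carrier: "v \<in> carrier_vec (q 1)"
  using v by (simp add: prob_vec_def)

lemma factor_carrier: "i \<in> {1..n} \<Longrightarrow> factor u i \<in> carrier_mat (q i) (q (i + 1))"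
  unfolding factor_def by (rule mult_carrier_mat[OF mat_inv_resolvent(3)[OF C] D])

lemma mittag_leffler_carrier:
  "i \<in> {1..n} \<Longrightarrow> mittag_leffler a b (s \<cdot>\<^sub>m C i) \<in> carrier_mat (q i) (q i)"
  using carrier_matD[OF C_carrier] by (intro carrier_matI) (simp_all add: mittag_leffler_def)

lemma kernel_carrier: "i \<in> {1..n} \<Longrightarrow> kernel i t \<in> carrier_mat (q i) (q (i + 1))"
  unfolding kernel_def by (intro smult_carrier_mat mult_carrier_mat[OF mittag_leffler_carrier D])

lemma kernel_entry:
  assumes i: "i \<in> {1..n}" and lj: "l < q i" "j < q (i + 1)"
  shows "kernel i t $$ (l, j) = t powr (\<alpha> i - 1) *
    (\<Sum>m<q i. mittag_leffler (\<alpha> i) (\<alpha> i) ((t powr \<alpha> i) \<cdot>\<^sub>m C i) $$ (l, m) * D i $$ (m, j))"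
  using mittag_leffler_carrier[OF i, of "\<alpha> i" "\<alpha> i" "t powr \<alpha> i"] D[OF i] lj
  by (simp add: kernel_def scalar_prod_def atLeast0LessThan)

lemma resolvent_factor:
  assumes i: "i \<in> {1..n}" and w: "w \<in> carrier_vec (q (i + 1))"
  shows "resolvent_mat (u i) (\<alpha> i) (C i) *\<^sub>v (factor u i *\<^sub>v w) = D i *\<^sub>v w"
proof -
  note R = mat_inv_resolvent(1,3,4)[OF C[OF i], of "u i" "\<alpha> i"]
  have Dw: "D i *\<^sub>v w \<in> carrier_vec (q i)" using D[OF i] w by simp
  have "factor u i *\<^sub>v w = mat_inv (resolvent_mat (u i) (\<alpha> i) (C i)) *\<^sub>v (D i *\<^sub>v w)"
    unfolding factor_def by (rule assoc_mult_mat_vec[OF R(2) D[OF i] w])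
  also have "resolvent_mat (u i) (\<alpha> i) (C i) *\<^sub>v \<dots>
      = (resolvent_mat (u i) (\<alpha> i) (C i) * mat_inv (resolvent_mat (u i) (\<alpha> i) (C i))) *\<^sub>v (D i *\<^sub>v w)"
    by (rule assoc_mult_mat_vec[symmetric, OF R(1,2) Dw])
  finally show ?thesis using Dw by (simp add: R(3))
qed

lemma block_laplace_eq_product:
  assumes p: "\<And>i. i \<in> {1..n} \<Longrightarrow> p i = q i"
  shows "block_vec n p (\<lambda>i. if i = 1 then v else 0\<^sub>v (p i))
        \<bullet> (mat_inv (block_mat n p (\<lambda>i j.
              if j = i then resolvent_mat (u i) (\<alpha> i) (C i)
              else if j = i + 1 then - D i
              else 0\<^sub>m (p i) (p j)))
           *\<^sub>v block_vec n p (\<lambda>i. if i = n then D n *\<^sub>v ones (q (n + 1)) else 0\<^sub>v (p i)))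
     = v \<bullet> (mat_prod (q 1) (factor u) n *\<^sub>v ones (q (n + 1)))"
proof -
  obtain w where w: "w (n + 1) = ones (q (n + 1))" "\<And>i. i \<in> {1..n} \<Longrightarrow> factor u i *\<^sub>v w (i + 1) = w i"
    using backward_recursion_exists[where A = "factor u"] by metis
  have wc: "w i \<in> carrier_vec (q i)" if "i \<in> {1..n + 1}" for i
  proof (cases "i = n + 1")
    case False
    then have i: "i \<in> {1..n}" using that by auto
    show ?thesis using mult_mat_vec_carrier_dim[OF factor_carrier[OF i, of u], of "w (i + 1)"] w(2)[OF i] by simp
  qed (use w(1) in simp)
  have "mat_inv (block_mat n p (\<lambda>i j.
              if j = i then resolvent_mat (u i) (\<alpha> i) (C i)
              else if j = i + 1 then - D i
              else 0\<^sub>m (p i) (p j)))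
           *\<^sub>v block_vec n p (\<lambda>i. if i = n then D n *\<^sub>v ones (q (n + 1)) else 0\<^sub>v (p i)) = block_vec n p w"
  proof (rule block_bidiagonal_solution)
    fix i assume i: "i \<in> {1..n}"
    show "resolvent_mat (u i) (\<alpha> i) (C i) \<in> carrier_mat (p i) (p i)"
      using mat_inv_resolvent(1)[OF C[OF i]] p[OF i] by simp
    show "y = 0\<^sub>v (p i)" if "y \<in> carrier_vec (p i)" "resolvent_mat (u i) (\<alpha> i) (C i) *\<^sub>v y = 0\<^sub>v (p i)" for y
      using mat_inv_resolvent(2)[OF C[OF i]] that p[OF i] by simp
    show "w i \<in> carrier_vec (p i)" using wc[of i] i p[OF i] by simp
  next
    fix i assume i: "i \<in> {1..<n}"
    then have i': "i \<in> {1..n}" "i + 1 \<in> {1..n}" by auto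
    show "D i \<in> carrier_mat (p i) (p (i + 1))" using D[OF i'(1)] p[OF i'(1)] p[OF i'(2)] by simp
    show "resolvent_mat (u i) (\<alpha> i) (C i) *\<^sub>v w i = D i *\<^sub>v w (i + 1)"
      using resolvent_factor[OF i'(1), of "w (i + 1)" u] w(2)[OF i'(1)] wc[of "i + 1"] i' by simp
  next
    show "resolvent_mat (u n) (\<alpha> n) (C n) *\<^sub>v w n = D n *\<^sub>v ones (q (n + 1))"
      using resolvent_factor[of n "w (n + 1)" u] w(2)[of n] w(1) n by simp
  qed
  then have first: "block_vec n p (\<lambda>i. if i = 1 then v else 0\<^sub>v (p i)) \<bullet>
      (mat_inv (block_mat n p (\<lambda>i j.
              if j = i then resolvent_mat (u i) (\<alpha> i) (C i)
              else if j = i + 1 then - D i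
              else 0\<^sub>m (p i) (p j)))
           *\<^sub>v block_vec n p (\<lambda>i. if i = n then D n *\<^sub>v ones (q (n + 1)) else 0\<^sub>v (p i))) = v \<bullet> w 1"
    using block_vec_first_scalar_prod[OF n, of v p w] v_carrier wc[of 1] p[of 1] n by simp
  have "mat_prod (q 1) (factor u) n *\<^sub>v w (n + 1) = mat_prod (q 1) (factor u) 0 *\<^sub>v w (0 + 1)"
    by (rule mat_prod_mult_tail[where n=n]) (use factor_carrier w wc in auto)
  then have tail: "mat_prod (q 1) (factor u) n *\<^sub>v ones (q (n + 1)) = w 1"
    using wc[of 1] w(1) by simp
  show ?thesis unfolding tail by (rule first)
qed

text \<open>
  Each block has its own threshold above which its Neumann series converges; \<open>c\<close> is a common one.
\<close>

lemma laplace_kernel_entries: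
  obtains c where "c \<ge> 0" "\<And>i u l j. i \<in> {1..n} \<Longrightarrow> u i \<ge> c \<Longrightarrow> l < q i \<Longrightarrow> j < q (i + 1) \<Longrightarrow>
    has_bochner_integral lborel (\<lambda>t. (indicator {0<..} t * exp (- (u i * t))) * kernel i t $$ (l, j)) (factor u i $$ (l, j))"
proof -
  have "\<forall>i\<in>{1..n}. \<exists>u0>0. \<forall>s\<ge>u0. \<forall>l<q i. \<forall>j<q i. has_bochner_integral lborel
     (\<lambda>t. indicator {0<..} t * (exp (- (s * t)) * t powr (\<alpha> i - 1) * mittag_leffler (\<alpha> i) (\<alpha> i) ((t powr \<alpha> i) \<cdot>\<^sub>m C i) $$ (l, j)))
     (mat_inv (resolvent_mat s (\<alpha> i) (C i)) $$ (l, j))"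
    by (intro ballI laplace_mittag_leffler_entry \<alpha> C_carrier)
  from bchoice[OF this] obtain u0 where u0: "\<And>i. i \<in> {1..n} \<Longrightarrow> u0 i > 0"
    "\<And>i s l j. i \<in> {1..n} \<Longrightarrow> s \<ge> u0 i \<Longrightarrow> l < q i \<Longrightarrow> j < q i \<Longrightarrow>
    has_bochner_integral lborel
     (\<lambda>t. indicator {0<..} t * (exp (- (s * t)) * t powr (\<alpha> i - 1) * mittag_leffler (\<alpha> i) (\<alpha> i) ((t powr \<alpha> i) \<cdot>\<^sub>m C i) $$ (l, j)))
     (mat_inv (resolvent_mat s (\<alpha> i) (C i)) $$ (l, j))"
    by blast
  have le: "u0 i \<le> (\<Sum>i=1..n. u0 i)" if "i \<in> {1..n}" for i
    using that u0(1) by (intro member_le_sum) (auto simp: less_imp_le)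
  show ?thesis
  proof (rule that)
    show "0 \<le> (\<Sum>i=1..n. u0 i)" using u0(1) by (intro sum_nonneg) (auto simp: less_imp_le)
    fix i l j and u :: "nat \<Rightarrow> real" assume i: "i \<in> {1..n}" and u: "u i \<ge> (\<Sum>i=1..n. u0 i)" and lj: "l < q i" "j < q (i + 1)"
    note R = mat_inv_resolvent(3)[OF C[OF i], of "u i" "\<alpha> i"]
    have "has_bochner_integral lborel
      (\<lambda>t. \<Sum>m<q i. indicator {0<..} t * (exp (- (u i * t)) * t powr (\<alpha> i - 1) * mittag_leffler (\<alpha> i) (\<alpha> i) ((t powr \<alpha> i) \<cdot>\<^sub>m C i) $$ (l, m)) * D i $$ (m, j))
      (\<Sum>m<q i. mat_inv (resolvent_mat (u i) (\<alpha> i) (C i)) $$ (l, m) * D i $$ (m, j))"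
      using le[OF i] u lj i by (intro has_bochner_integral_sum has_bochner_integral_mult_left u0(2)) auto
    moreover have "factor u i $$ (l, j) = (\<Sum>m<q i. mat_inv (resolvent_mat (u i) (\<alpha> i) (C i)) $$ (l, m) * D i $$ (m, j))"
      using R D[OF i] lj by (simp add: factor_def scalar_prod_def atLeast0LessThan)
    ultimately show "has_bochner_integral lborel
        (\<lambda>t. (indicator {0<..} t * exp (- (u i * t))) * kernel i t $$ (l, j)) (factor u i $$ (l, j))"
      by (simp add: kernel_entry[OF i lj] sum_distrib_left mult_ac)
  qed
qed

lemma continuous_on_kernel_entry:
  assumes i: "i \<in> {1..n}" and lj: "l < q i" "j < q (i + 1)"
  shows "continuous_on {0<..} (\<lambda>t. kernel i t $$ (l, j))"
proof -
  have "continuous_on {0<..} (\<lambda>t. mittag_leffler (\<alpha> i) (\<alpha> i) ((t powr \<alpha> i) \<cdot>\<^sub>m C i) $$ (l, m))" if "m < q i" for m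
  proof (rule continuous_on_compose2[where t = UNIV and g = "\<lambda>s. mittag_leffler (\<alpha> i) (\<alpha> i) (s \<cdot>\<^sub>m C i) $$ (l, m)"])
    show "continuous_on UNIV (\<lambda>s. mittag_leffler (\<alpha> i) (\<alpha> i) (s \<cdot>\<^sub>m C i) $$ (l, m))"
      using isCont_mittag_leffler_entry[OF \<alpha>[OF i] C_carrier[OF i] lj(1) that]
      by (simp add: continuous_at_imp_continuous_on)
    show "continuous_on {0<..} (\<lambda>t. t powr \<alpha> i)" by (intro continuous_intros) auto
  qed simp
  then show ?thesis unfolding kernel_entry[OF i lj] by (auto intro!: continuous_intros)
qed

definition density_fun :: "(nat \<Rightarrow> real) \<Rightarrow> real" where
  "density_fun x = v \<bullet> (mat_prod (q 1) (\<lambda>i. kernel i (x i)) n *\<^sub>v ones (q (n + 1)))"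

lemma scalar_prod_mat_prod_ones:
  assumes "\<And>i. i \<in> {1..n} \<Longrightarrow> A i \<in> carrier_mat (q i) (q (i + 1))"
  shows "v \<bullet> (mat_prod (q 1) A n *\<^sub>v ones (q (n + 1))) = (\<Sum>j<q (n + 1). row_mult v (mat_prod (q 1) A n) $ j)"
proof -
  have P: "mat_prod (q 1) A n \<in> carrier_mat (q 1) (q (n + 1))"
    by (rule mat_prod_carrier[where n=n]) (use assms in auto)
  show ?thesis
    unfolding row_mult_scalar_prod[OF P ones_carrier(1) v_carrier]
    by (rule scalar_prod_ones[OF row_mult_carrier[OF P]])
qed

lemma continuous_on_density_fun: "continuous_on {x. \<forall>i\<in>{1..n}. 0 < x i} density_fun"
proof -
  have "density_fun = (\<lambda>x. \<Sum>j<q (n + 1). row_mult v (mat_prod (q 1) (\<lambda>i. kernel i (x i)) n) $ j)"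
    unfolding density_fun_def by (intro ext scalar_prod_mat_prod_ones kernel_carrier)
  moreover have "continuous_on {x. \<forall>i\<in>{1..n}. 0 < x i}
      (\<lambda>x. row_mult v (mat_prod (q 1) (\<lambda>i. kernel i (x i)) n) $ j)" if "j < q (n + 1)" for j
  proof (rule continuous_on_row_mult_mat_prod[where n=n and A = "\<lambda>i x. kernel i (x i)"])
    fix i l j assume i: "i \<in> {1..n}" and lj: "l < q i" "j < q (i + 1)"
    show "continuous_on {x. \<forall>i\<in>{1..n}. 0 < x i} (\<lambda>x. kernel i (x i) $$ (l, j))"
      by (rule continuous_on_compose2[OF continuous_on_kernel_entry[OF i lj]])
        (use i in \<open>auto intro: continuous_on_subset[OF continuous_on_product_coordinates]\<close>)
  qed (use kernel_carrier v_carrier that in auto)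
  ultimately show ?thesis by (auto intro!: continuous_on_sum)
qed

lemma laplace_density_fun:
  obtains c where "c \<ge> 0" "\<And>u. (\<And>i. i \<in> {1..n} \<Longrightarrow> u i \<ge> c) \<Longrightarrow>
    has_bochner_integral (\<Pi>\<^sub>M i\<in>{1..n}. lborel)
      (\<lambda>x. (\<Prod>i=1..n. indicator {0<..} (x i) * exp (- (u i * x i))) * density_fun x)
      (v \<bullet> (mat_prod (q 1) (factor u) n *\<^sub>v ones (q (n + 1))))"
proof -
  obtain c where c: "c \<ge> 0" "\<And>i u l j. i \<in> {1..n} \<Longrightarrow> u i \<ge> c \<Longrightarrow> l < q i \<Longrightarrow> j < q (i + 1) \<Longrightarrow>
    has_bochner_integral lborel (\<lambda>t. (indicator {0<..} t * exp (- (u i * t))) * kernel i t $$ (l, j)) (factor u i $$ (l, j))"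
    using laplace_kernel_entries by blast
  show ?thesis
  proof (rule that[OF c(1)])
    fix u :: "nat \<Rightarrow> real" assume u: "\<And>i. i \<in> {1..n} \<Longrightarrow> u i \<ge> c"
    define s where "s i t = indicator {0<..} t * exp (- (u i * t))" for i and t :: real
    have sc: "s i t \<cdot>\<^sub>m kernel i t \<in> carrier_mat (q i) (q (i + 1))" if "i \<in> {1..n}" for i t
      by (intro smult_carrier_mat kernel_carrier that)
    have "has_bochner_integral (\<Pi>\<^sub>M i\<in>{1..n}. lborel)
      (\<lambda>x. \<Sum>j<q (n + 1). row_mult v (mat_prod (q 1) (\<lambda>i. s i (x i) \<cdot>\<^sub>m kernel i (x i)) n) $ j)
      (\<Sum>j<q (n + 1). row_mult v (mat_prod (q 1) (factor u) n) $ j)"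
    proof (rule has_bochner_integral_sum)
      fix j assume j: "j \<in> {..<q (n + 1)}"
      show "has_bochner_integral (\<Pi>\<^sub>M i\<in>{1..n}. lborel)
        (\<lambda>x. row_mult v (mat_prod (q 1) (\<lambda>i. s i (x i) \<cdot>\<^sub>m kernel i (x i)) n) $ j)
        (row_mult v (mat_prod (q 1) (factor u) n) $ j)"
      proof (rule has_bochner_integral_row_mult_mat_prod[where A = "\<lambda>i t. s i t \<cdot>\<^sub>m kernel i t" and n = n])
        fix i l j assume i: "i \<in> {1..n}" and lj: "l < q i" "j < q (i + 1)"
        have "(s i t \<cdot>\<^sub>m kernel i t) $$ (l, j) = s i t * kernel i t $$ (l, j)" for t
          using kernel_carrier[OF i, of t] lj by simp
        then show "has_bochner_integral lborel (\<lambda>t. (s i t \<cdot>\<^sub>m kernel i t) $$ (l, j)) (factor u i $$ (l, j))"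
          using c(2)[where u = u and i = i and l = l and j = j, OF i u[OF i] lj] by (simp add: s_def)
      qed (use sc factor_carrier v_carrier j in auto)
    qed
    also have "(\<Sum>j<q (n + 1). row_mult v (mat_prod (q 1) (factor u) n) $ j)
        = v \<bullet> (mat_prod (q 1) (factor u) n *\<^sub>v ones (q (n + 1)))"
      by (rule scalar_prod_mat_prod_ones[symmetric]) (rule factor_carrier)
    also have "(\<lambda>x. \<Sum>j<q (n + 1). row_mult v (mat_prod (q 1) (\<lambda>i. s i (x i) \<cdot>\<^sub>m kernel i (x i)) n) $ j)
        = (\<lambda>x. (\<Prod>i=1..n. s i (x i)) * density_fun x)"
    proof
      fix x
      let ?K = "mat_prod (q 1) (\<lambda>i. kernel i (x i)) n"
      have df: "density_fun x = (\<Sum>j<q (n + 1). row_mult v ?K $ j)"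
        unfolding density_fun_def by (intro scalar_prod_mat_prod_ones kernel_carrier)
      have K: "?K \<in> carrier_mat (q 1) (q (n + 1))"
        by (rule mat_prod_carrier[where n=n]) (use kernel_carrier in auto)
      have "mat_prod (q 1) (\<lambda>i. s i (x i) \<cdot>\<^sub>m kernel i (x i)) n = (\<Prod>i=1..n. s i (x i)) \<cdot>\<^sub>m ?K"
        by (rule mat_prod_smult[where n=n]) (use kernel_carrier in auto)
      moreover have "row_mult v (b \<cdot>\<^sub>m ?K) $ j = b * row_mult v ?K $ j" if "j < q (n + 1)" for b j
        using K v_carrier that by (simp add: row_mult_def scalar_prod_def sum_distrib_left mult_ac)
      ultimately show "(\<Sum>j<q (n + 1). row_mult v (mat_prod (q 1) (\<lambda>i. s i (x i) \<cdot>\<^sub>m kernel i (x i)) n) $ j)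
          = (\<Prod>i=1..n. s i (x i)) * density_fun x"
        by (simp add: df sum_distrib_left)
    qed
    finally show "has_bochner_integral (\<Pi>\<^sub>M i\<in>{1..n}. lborel)
      (\<lambda>x. (\<Prod>i=1..n. indicator {0<..} (x i) * exp (- (u i * x i))) * density_fun x)
      (v \<bullet> (mat_prod (q 1) (factor u) n *\<^sub>v ones (q (n + 1))))"
      by (simp add: s_def)
  qed
qed

lemma has_joint_density_of_laplace:
  assumes M: "prob_space M"
    and X: "\<And>i. i \<in> {1..n} \<Longrightarrow> X i \<in> borel_measurable M"
    and X0: "\<And>i \<omega>. i \<in> {1..n} \<Longrightarrow> \<omega> \<in> space M \<Longrightarrow> 0 \<le> X i \<omega>"
    and laplace: "\<And>u. (\<forall>i\<in>{1..n}. 0 \<le> u i) \<Longrightarrow>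
      joint_laplace M n X u = v \<bullet> (mat_prod (q 1) (factor u) n *\<^sub>v ones (q (n + 1)))"
  shows "has_joint_density M n X density_fun"
proof -
  obtain c where c: "c \<ge> 0" "\<And>u. (\<And>i. i \<in> {1..n} \<Longrightarrow> u i \<ge> c) \<Longrightarrow>
    has_bochner_integral (\<Pi>\<^sub>M i\<in>{1..n}. lborel)
      (\<lambda>x. (\<Prod>i=1..n. indicator {0<..} (x i) * exp (- (u i * x i))) * density_fun x)
      (v \<bullet> (mat_prod (q 1) (factor u) n *\<^sub>v ones (q (n + 1))))"
    using laplace_density_fun by blast
  have lap: "has_bochner_integral (\<Pi>\<^sub>M i\<in>{1..n}. lborel)
      (\<lambda>x. (\<Prod>i\<in>{1..n}. indicator {0<..} (x i) * exp (- ((c + real (k i)) * x i))) * density_fun x)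
      (\<integral>\<omega>. exp (- (\<Sum>i\<in>{1..n}. (c + real (k i)) * X i \<omega>)) \<partial>M)" for k :: "nat \<Rightarrow> nat"
    using c(2)[of "\<lambda>i. c + real (k i)"] laplace[of "\<lambda>i. c + real (k i)"] c(1)
    by (simp add: joint_laplace_def)
  have local: "density_fun x = density_fun y" if "\<And>i. i \<in> {1..n} \<Longrightarrow> x i = y i" for x y
  proof -
    have "mat_prod (q 1) (\<lambda>i. kernel i (x i)) n = mat_prod (q 1) (\<lambda>i. kernel i (y i)) n"
      by (rule mat_prod_cong) (use that in simp)
    then show ?thesis by (simp add: density_fun_def)
  qed
  note main = density_of_laplace_transform[OF M _ c(1) X X0 lap continuous_on_density_fun local]
  show ?thesis
    unfolding has_joint_density_def using main by simp
qed

text \<open>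
  The distribution of the state in which the \<open>i\<close>-th block is entered.
\<close>

definition entrance :: "nat \<Rightarrow> real vec" where
  "entrance i = row_mult v (mat_prod (q 1) (\<lambda>j. mat_inv (- C j) * D j) (i - 1))"

lemma entrance_factor_carrier: "i \<in> {1..n} \<Longrightarrow> mat_inv (- C i) * D i \<in> carrier_mat (q i) (q (i + 1))"
  using factor_carrier[of i "\<lambda>_. 0"] C_carrier[of i] by (simp add: factor_def resolvent_mat_zero)

lemma entrance_prob_vec:
  assumes i: "i \<in> {1..n}"
  shows "prob_vec (q i) (entrance i)"
proof -
  let ?A = "\<lambda>j. mat_inv (- C j) * D j"
  have i1: "i - 1 \<le> n" "i - 1 + 1 = i" using i by auto
  have P: "mat_prod (q 1) ?A (i - 1) \<in> carrier_mat (q 1) (q i)"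
    using mat_prod_carrier[where A = ?A and q = q, OF entrance_factor_carrier i1(1)] i1(2) by simp
  have nonneg: "0 \<le> ?A k $$ (l, j)" if k: "k \<in> {1..n}" and lj: "l < q k" "j < q (k + 1)" for k l j
  proof -
    have N: "mat_inv (- C k) \<in> carrier_mat (q k) (q k)"
      using mat_inv_resolvent(3)[OF C[OF k], of 0 1] C_carrier[OF k] by (simp add: resolvent_mat_zero)
    have "?A k $$ (l, j) = (\<Sum>m<q k. mat_inv (- C k) $$ (l, m) * D k $$ (m, j))"
      using N D[OF k] lj by (simp add: scalar_prod_def atLeast0LessThan)
    also have "\<dots> \<ge> 0"
      using uminus_sub_intensity_inverse_nonneg[OF C[OF k] lj(1)] D0[OF k] D[OF k] lj
      by (intro sum_nonneg mult_nonneg_nonneg) (auto simp: nonneg_mat_def)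
    finally show ?thesis .
  qed
  have "0 \<le> entrance i $ j" if "j < q i" for j
    unfolding entrance_def
    by (rule row_mult_mat_prod_nonneg[where n=n])
      (use entrance_factor_carrier nonneg v i1 that in \<open>auto simp: prob_vec_def\<close>)
  moreover have "(\<Sum>j<q i. entrance i $ j) = 1"
  proof -
    have "mat_prod (q 1) ?A (i - 1) *\<^sub>v ones (q (i - 1 + 1)) = mat_prod (q 1) ?A 0 *\<^sub>v ones (q (0 + 1))"
    proof (rule mat_prod_mult_tail[where n = "i - 1" and w = "\<lambda>j. ones (q j)"])
      show "?A k \<in> carrier_mat (q k) (q (k + 1))" if "k \<in> {1..i - 1}" for k
        using that i by (intro entrance_factor_carrier) auto
      show "?A k *\<^sub>v ones (q (k + 1)) = ones (q k)" if "k \<in> {0 + 1..i - 1}" for k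
        using that i by (intro sub_intensity_stochastic C D CD) auto
    qed simp_all
    then have absorb: "mat_prod (q 1) ?A (i - 1) *\<^sub>v ones (q i) = ones (q 1)"
      unfolding i1(2) by simp
    have "(\<Sum>j<q i. entrance i $ j) = entrance i \<bullet> ones (q i)"
      unfolding entrance_def by (rule scalar_prod_ones[symmetric, OF row_mult_carrier[OF P]])
    also have "\<dots> = v \<bullet> (mat_prod (q 1) ?A (i - 1) *\<^sub>v ones (q i))"
      unfolding entrance_def by (rule row_mult_scalar_prod[symmetric, OF P ones_carrier(1) v_carrier])
    also have "\<dots> = 1"
      unfolding absorb using v by (simp add: prob_vec_def scalar_prod_ones)
    finally show ?thesis .
  qed
  moreover have "entrance i \<in> carrier_vec (q i)" unfolding entrance_def by (rule row_mult_carrier[OF P])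
  ultimately show ?thesis by (simp add: prob_vec_def)
qed

text \<open>
  The factors behind the \<open>i\<close>-th one fix the vector of ones, and in the \<open>i\<close>-th one
  \<open>D i *\<^sub>v ones (q (i + 1))\<close> is the exit rate vector \<open>- (C i *\<^sub>v ones (q i))\<close>.
\<close>

lemma product_at_single_coordinate:
  assumes i: "i \<in> {1..n}"
  shows "v \<bullet> (mat_prod (q 1) (factor (\<lambda>j. if j = i then s else 0)) n *\<^sub>v ones (q (n + 1)))
    = entrance i \<bullet> (mat_inv (resolvent_mat s (\<alpha> i) (C i)) *\<^sub>v (- (C i *\<^sub>v ones (q i))))"
proof -
  let ?u = "\<lambda>j. if j = i then s else 0"
  let ?A = "\<lambda>j. mat_inv (- C j) * D j"
  have factor_off: "factor ?u j = ?A j" if "j \<in> {1..n}" "j \<noteq> i" for j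
    using that C_carrier[of j] by (simp add: factor_def resolvent_mat_zero)
  have i1: "i - 1 \<le> n" "i - 1 + 1 = i" using i by auto
  have P: "mat_prod (q 1) ?A (i - 1) \<in> carrier_mat (q 1) (q i)"
    using mat_prod_carrier[where A = ?A and q = q, OF entrance_factor_carrier i1(1)] i1(2) by simp
  have N: "mat_inv (resolvent_mat s (\<alpha> i) (C i)) \<in> carrier_mat (q i) (q i)"
    by (rule mat_inv_resolvent(3)[OF C[OF i]])
  define y where "y = mat_inv (resolvent_mat s (\<alpha> i) (C i)) *\<^sub>v (- (C i *\<^sub>v ones (q i)))"
  have y: "y \<in> carrier_vec (q i)" unfolding y_def by (rule mult_mat_vec_carrier_dim[OF N])
  define w where "w j = (if j = i then y else ones (q j))" for j
  have "mat_prod (q 1) (factor ?u) n *\<^sub>v w (n + 1) = mat_prod (q 1) (factor ?u) (i - 1) *\<^sub>v w (i - 1 + 1)"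
  proof (rule mat_prod_mult_tail[where n = n and w = w])
    fix j assume "j \<in> {i - 1 + 1..n}"
    then have j: "j \<in> {1..n}" "i \<le> j" using i by auto
    show "factor ?u j *\<^sub>v w (j + 1) = w j"
    proof (cases "j = i")
      case True
      have "factor ?u i *\<^sub>v ones (q (i + 1)) = mat_inv (resolvent_mat s (\<alpha> i) (C i)) *\<^sub>v (D i *\<^sub>v ones (q (i + 1)))"
        unfolding factor_def using assoc_mult_mat_vec[OF N D[OF i] ones_carrier(1)] by simp
      then show ?thesis using True by (simp add: w_def y_def CD[OF i])
    next
      case False
      then show ?thesis
        using j sub_intensity_stochastic[OF C[OF j(1)] D[OF j(1)] CD[OF j(1)]]
        by (simp add: w_def factor_off)
    qed
  qed (use i factor_carrier in \<open>auto simp: w_def\<close>)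
  moreover have "mat_prod (q 1) (factor ?u) (i - 1) = mat_prod (q 1) ?A (i - 1)"
    by (rule mat_prod_cong) (use i factor_off in auto)
  ultimately have "mat_prod (q 1) (factor ?u) n *\<^sub>v ones (q (n + 1)) = mat_prod (q 1) ?A (i - 1) *\<^sub>v y"
    using i by (simp add: w_def)
  then show ?thesis
    unfolding entrance_def y_def[symmetric] row_mult_scalar_prod[OF P y v_carrier, symmetric] by simp
qed

lemma marginal_mml:
  assumes X: "X i \<in> borel_measurable M"
    and X0: "\<And>\<omega>. \<omega> \<in> space M \<Longrightarrow> 0 \<le> X i \<omega>"
    and laplace: "\<And>u. (\<forall>i\<in>{1..n}. 0 \<le> u i) \<Longrightarrow>
      joint_laplace M n X u = v \<bullet> (mat_prod (q 1) (factor u) n *\<^sub>v ones (q (n + 1)))"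
    and i: "i \<in> {1..n}" and "\<alpha> i \<le> 1"
  shows "mml M (X i) (\<alpha> i) (entrance i) (C i)"
proof -
  have dim: "dim_vec (entrance i) = q i"
    using entrance_prob_vec[OF i] by (simp add: prob_vec_def)
  have "(\<integral>\<omega>. exp (- (s * X i \<omega>)) \<partial>M)
      = entrance i \<bullet> (mat_inv (resolvent_mat s (\<alpha> i) (C i)) *\<^sub>v (- (C i *\<^sub>v ones (q i))))" if "s \<ge> 0" for s
  proof -
    let ?u = "\<lambda>j. if j = i then s else 0"
    have "(\<Sum>j=1..n. ?u j * X j \<omega>) = s * X i \<omega>" for \<omega>
      using i by (simp add: if_distrib[of "\<lambda>a. a * _"] cong: if_cong)
    then have "(\<integral>\<omega>. exp (- (s * X i \<omega>)) \<partial>M) = joint_laplace M n X ?u"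
      by (simp add: joint_laplace_def)
    then show ?thesis
      using laplace[of ?u] that product_at_single_coordinate[OF i] by simp
  qed
  then show ?thesis
    using X X0 \<alpha>[OF i] \<open>\<alpha> i \<le> 1\<close> entrance_prob_vec[OF i] C[OF i] by (simp add: mml_def dim)
qed

end

theorem theorem8:
  fixes M :: "'w measure" and X :: "nat \<Rightarrow> 'w \<Rightarrow> real"
    and n :: nat and \<alpha> :: "nat \<Rightarrow> real" and p :: "nat \<Rightarrow> nat"
    and C D :: "nat \<Rightarrow> real mat" and \<pi> :: "real vec"
  assumes "n \<ge> 1"
    and "\<And>i. i \<in> {1..n} \<Longrightarrow> 0 < \<alpha> i \<and> \<alpha> i \<le> 1"
    and "\<And>i. i \<in> {1..n} \<Longrightarrow> 0 < p i"
    and "\<And>i. i \<in> {1..n} \<Longrightarrow> sub_intensity (p i) (C i)"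
    and "\<And>i. i \<in> {1..n} \<Longrightarrow> nonneg_mat (D i)"
    and "\<And>i. i \<in> {1..n} \<Longrightarrow> dim_row (D i) = p i"
    and "\<And>i. i \<in> {1..<n} \<Longrightarrow> dim_col (D i) = p (i + 1)"
    and "\<And>i. i \<in> {1..n} \<Longrightarrow> - (C i *\<^sub>v ones (p i)) = D i *\<^sub>v ones (dim_col (D i))"
    and "prob_vec (p 1) \<pi>"
    and "prob_space M"
    and "\<And>i. i \<in> {1..n} \<Longrightarrow> X i \<in> borel_measurable M"
    and "\<And>i \<omega>. i \<in> {1..n} \<Longrightarrow> \<omega> \<in> space M \<Longrightarrow> 0 \<le> X i \<omega>"
    and "\<And>u. (\<forall>i\<in>{1..n}. 0 \<le> u i) \<Longrightarrow>
      joint_laplace M n X u =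
        block_vec n p (\<lambda>i. if i = 1 then \<pi> else 0\<^sub>v (p i))
        \<bullet> (mat_inv (block_mat n p (\<lambda>i j.
              if j = i then resolvent_mat (u i) (\<alpha> i) (C i)
              else if j = i + 1 then - D i
              else 0\<^sub>m (p i) (p j)))
           *\<^sub>v block_vec n p (\<lambda>i. if i = n then D n *\<^sub>v ones (dim_col (D n)) else 0\<^sub>v (p i)))"
  shows "(\<forall>u. (\<forall>i\<in>{1..n}. 0 \<le> u i) \<longrightarrow>
      joint_laplace M n X u =
        \<pi> \<bullet> (mat_prod (p 1) (\<lambda>i. mat_inv (resolvent_mat (u i) (\<alpha> i) (C i)) * D i) n
              *\<^sub>v ones (dim_col (D n))))
    \<and> has_joint_density M n X (\<lambda>x.
        \<pi> \<bullet> (mat_prod (p 1)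
                (\<lambda>i. (x i powr (\<alpha> i - 1)) \<cdot>\<^sub>m
                       (mittag_leffler (\<alpha> i) (\<alpha> i) ((x i powr \<alpha> i) \<cdot>\<^sub>m C i) * D i)) n
              *\<^sub>v ones (dim_col (D n))))
    \<and> (\<forall>i\<in>{1..n}.
        mml M (X i) (\<alpha> i)
          (row_mult \<pi> (mat_prod (p 1) (\<lambda>j. mat_inv (- C j) * D j) (i - 1))) (C i))"
proof -
  define q where "q i = (if i = n + 1 then dim_col (D n) else p i)" for i
  have q_p: "q i = p i" if "i \<in> {1..n}" for i using that by (simp add: q_def)
  have q_last: "q (n + 1) = dim_col (D n)" by (simp add: q_def)
  have q_col: "dim_col (D i) = q (i + 1)" if "i \<in> {1..n}" for i
    using that assms(7)[of i] by (cases "i = n") (auto simp: q_def)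
  have q1: "q 1 = p 1" using q_p[of 1] assms(1) by simp
  interpret mml_chain n \<alpha> q C D \<pi>
  proof
    fix i assume i: "i \<in> {1..n}"
    show "0 < \<alpha> i" using assms(2)[OF i] by simp
    show "sub_intensity (q i) (C i)" using assms(4)[OF i] q_p[OF i] by simp
    show "D i \<in> carrier_mat (q i) (q (i + 1))"
      using assms(6)[OF i] q_col[OF i] q_p[OF i] by (intro carrier_matI) simp_all
    show "nonneg_mat (D i)" by (rule assms(5)[OF i])
    show "- (C i *\<^sub>v ones (q i)) = D i *\<^sub>v ones (q (i + 1))"
      using assms(8)[OF i] by (simp only: q_col[OF i] q_p[OF i])
  qed (use assms(1,9) q1 in simp_all)
  have laplace: "joint_laplace M n X u = \<pi> \<bullet> (mat_prod (q 1) (factor u) n *\<^sub>v ones (q (n + 1)))"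
    if u: "\<forall>i\<in>{1..n}. 0 \<le> u i" for u
    unfolding assms(13)[OF u] q_last[symmetric]
    by (rule block_laplace_eq_product) (simp add: q_p)
  show ?thesis
  proof (intro conjI allI impI ballI)
    fix u :: "nat \<Rightarrow> real" assume u: "\<forall>i\<in>{1..n}. 0 \<le> u i"
    show "joint_laplace M n X u = \<pi> \<bullet> (mat_prod (p 1) (\<lambda>i. mat_inv (resolvent_mat (u i) (\<alpha> i) (C i)) * D i) n
              *\<^sub>v ones (dim_col (D n)))"
      using laplace[OF u] unfolding factor_def q1 q_last .
  next
    have "has_joint_density M n X density_fun"
      by (rule has_joint_density_of_laplace[OF assms(10,11,12) laplace])
    then show "has_joint_density M n X (\<lambda>x.
        \<pi> \<bullet> (mat_prod (p 1)
                (\<lambda>i. (x i powr (\<alpha> i - 1)) \<cdot>\<^sub>m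
                       (mittag_leffler (\<alpha> i) (\<alpha> i) ((x i powr \<alpha> i) \<cdot>\<^sub>m C i) * D i)) n
              *\<^sub>v ones (dim_col (D n))))"
      unfolding density_fun_def kernel_def q1 q_last .
  next
    fix i assume i: "i \<in> {1..n}"
    have "mml M (X i) (\<alpha> i) (entrance i) (C i)"
      by (rule marginal_mml[OF assms(11)[OF i] assms(12)[OF i] laplace i]) (use assms(2)[OF i] in simp_all)
    then show "mml M (X i) (\<alpha> i)
          (row_mult \<pi> (mat_prod (p 1) (\<lambda>j. mat_inv (- C j) * D j) (i - 1))) (C i)"
      unfolding entrance_def q1 .
  qed
qed

end
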